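(* Let $\beta>0$. Let $m,n\to\infty$ (with $n=n_m$ and $P=P_m$ depending on $m$) so that $mn^{-1}\to\beta$. Let $X_1$ have distribution $P$, and let $d=d(w_1)$ and $L=L(w_1)$ be the degree of $w_1$ and the number of links incident to $w_1$ in the passive random intersection graph $G^*_1(n,m,P)$. Assume that there is a random variable $Z$ such that: (vii) $X_1$ converges in distribution to $Z$; (viii) $\mathbf E Z<\infty$ and $\lim_{m\to\infty}\mathbf E X_1=\mathbf E Z$. Then $L$ converges in distribution to the compound Poisson random variable $d_*=\sum_{j=1}^{\Lambda}\tilde Z_j$, where $\tilde Z_1,\tilde Z_2,\dots$ are independent random variables with common probability distribution $\tilde P_Z$, and the random variable $\Lambda$ is independent of the sequence $\tilde Z_1,\tilde Z_2,\dots$ and has Poisson distribution with mean $\mathbf E\Lambda=\beta^{-1}\mathbf E Z$. If, in addition, (ix) $\mathbf E Z^{4/3}<\infty$ and $\lim_{m\to\infty}\mathbf E X_1^{4/3}=\mathbf E Z^{4/3}$, then $d$ converges in distribution to $d_*$.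
   Context: Passive random intersection graph $G^*_1(n,m,P)$: let $W=\{w_1,\dots,w_m\}$ and let $P$ be a probability distribution on $\{0,1,\dots,m\}$. Let $D_1,\dots,D_n$ be independent identically distributed random subsets of $W$ with $\mathbf P(D_i=A)=P(|A|)\binom{m}{|A|}^{-1}$ for each $A\subset W$; write $X_i=|D_i|$, so $X_i$ has distribution $P$. The vertex set is $W$; distinct $w,w'\in W$ are adjacent iff $\{w,w'\}\subset D_j$ for at least one $j$. Each $D_j$ containing both $w$ and $w'$ contributes one link between $w$ and $w'$; thus the number of links incident to $w_1$ is $L=\sum_{j=1}^n(|D_j|-1)\mathbb I_{\{w_1\in D_j\}}$, while $d$ counts distinct neighbours of $w_1$. For a random variable $Z$ with values in $\{0,1,2,\dots\}$ and $\mathbf E Z<\infty$, the distribution $\tilde P_Z$ on $\{0,1,2,\dots\}$ puts mass $(j+1)\mathbf P(Z=j+1)/\mathbf E Z$ on $j=0,1,2,\dots$ if $\mathbf E Z>0$, and puts mass $1$ on $0$ if $\mathbf E Z=0$. *)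

theory Defs
  imports "HOL-Probability.Probability"
begin

text \<open>
  The attribute set is \<open>W = {1..m}\<close>, with \<open>w\<^sub>j\<close> represented by \<open>j\<close>; the random subsets of \<open>W\<close>
  are \<open>D 1, \<dots>, D n\<close>. No particular probability space is chosen: the locale describes an
  arbitrary realisation of the model.
\<close>

locale passive_random_intersection_graph = prob_space M
  for M :: "'a measure" +
  fixes n m :: nat and P :: "nat pmf" and D :: "nat \<Rightarrow> 'a \<Rightarrow> nat set"
  assumes set_pmf_P: "set_pmf P \<subseteq> {0..m}"
    and indep_D: "indep_vars (\<lambda>_. count_space (Pow {1..m})) D {1..n}"
    and prob_D: "\<And>i A. i \<in> {1..n} \<Longrightarrow> A \<subseteq> {1..m} \<Longrightarrow>
      \<P>(\<omega> in M. D i \<omega> = A) = pmf P (card A) / real (m choose card A)"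

text \<open>The next three definitions refer to one outcome \<open>D 1, \<dots>, D n\<close> of the random sets.\<close>

definition rig_adj :: "nat \<Rightarrow> (nat \<Rightarrow> nat set) \<Rightarrow> nat \<Rightarrow> nat \<Rightarrow> bool" where
  "rig_adj n D w w' \<longleftrightarrow> w \<noteq> w' \<and> (\<exists>j\<in>{1..n}. {w, w'} \<subseteq> D j)"

definition rig_degree :: "nat \<Rightarrow> nat \<Rightarrow> (nat \<Rightarrow> nat set) \<Rightarrow> nat \<Rightarrow> nat" where
  "rig_degree n m D w = card {w' \<in> {1..m}. rig_adj n D w w'}"

text \<open>
  The subtraction does not truncate for finite \<open>D j\<close>, since \<open>w \<in> D j\<close> forces \<open>card (D j) \<ge> 1\<close>.
\<close>

definition rig_links :: "nat \<Rightarrow> (nat \<Rightarrow> nat set) \<Rightarrow> nat \<Rightarrow> nat" where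
  "rig_links n D w = (\<Sum>j\<in>{1..n}. if w \<in> D j then card (D j) - 1 else 0)"

text \<open>The mass function of the distribution \<open>P~\<^sub>Z\<close> (the size-biased law of \<open>Z\<close> shifted by one), for \<open>Z\<close> with finite mean.\<close>

definition size_biased_mass :: "'b measure \<Rightarrow> ('b \<Rightarrow> nat) \<Rightarrow> nat \<Rightarrow> real" where
  "size_biased_mass N Z j =
    (let EZ = (\<integral>\<omega>. real (Z \<omega>) \<partial>N) in
      if EZ > 0 then real (j + 1) * \<P>(\<omega> in N. Z \<omega> = j + 1) / EZ
      else if j = 0 then 1 else 0)"

text \<open>
  The Poisson masses are written out because the library's \<open>poisson_pmf\<close> requires a strictly
  positive rate, whereas rate \<open>0\<close> (unit mass at \<open>0\<close>) must be allowed here. The independence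
  of \<open>\<Lambda>\<close> and the sequence \<open>Zt\<close> is stated through the generated \<open>\<sigma>\<close>-algebras, as \<open>indep_var\<close>
  requires both variables to have the same type.
\<close>

locale compound_poisson = prob_space S
  for S :: "'c measure" +
  fixes rate :: real and q :: "nat \<Rightarrow> real"
    and \<Lambda> :: "'c \<Rightarrow> nat" and Zt :: "nat \<Rightarrow> 'c \<Rightarrow> nat"
  assumes indep_Zt: "indep_vars (\<lambda>_. count_space UNIV) Zt {1..}"
    and prob_Zt: "\<And>i j. i \<ge> 1 \<Longrightarrow> \<P>(\<omega> in S. Zt i \<omega> = j) = q j"
    and measurable_\<Lambda>: "random_variable (count_space UNIV) \<Lambda>"
    and prob_\<Lambda>: "\<And>k. \<P>(\<omega> in S. \<Lambda> \<omega> = k) = rate ^ k / fact k * exp (- rate)"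
    and indep_\<Lambda>_Zt: "indep_set
      (sets (vimage_algebra (space S) \<Lambda> (count_space UNIV)))
      (sets (vimage_algebra (space S) (\<lambda>\<omega>. \<lambda>i\<in>{1..}. Zt i \<omega>) (\<Pi>\<^sub>M i\<in>{1..}. count_space UNIV)))"

definition random_sum :: "('c \<Rightarrow> nat) \<Rightarrow> (nat \<Rightarrow> 'c \<Rightarrow> nat) \<Rightarrow> 'c \<Rightarrow> nat" where
  "random_sum \<Lambda> Zt \<omega> = (\<Sum>j\<in>{1..\<Lambda> \<omega>}. Zt j \<omega>)"

text \<open>The law on the real line of a natural-number valued random variable.\<close>

definition real_law :: "'a measure \<Rightarrow> ('a \<Rightarrow> nat) \<Rightarrow> real measure" where
  "real_law M X = distr M borel (\<lambda>\<omega>. real (X \<omega>))"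

end

theory Submission
  imports Defs
begin

text \<open>
  The summands of \<open>L\<close> are i.i.d.; since \<open>w\<^sub>1\<close> lies in a uniformly chosen \<open>k\<close>-subset of \<open>W\<close> with
  probability \<open>k / m\<close>, the characteristic function of \<open>L\<close> is \<open>(1 + c\<^sub>m(t) / m)\<^sup>n\<close> with
  \<open>c\<^sub>m(t) = E (X\<^sub>1 (exp (i t (X\<^sub>1 - 1)) - 1))\<close>. Convergence in distribution and of the means makes the
  size-biased laws converge in total variation, so \<open>c\<^sub>m(t) \<longlonglongrightarrow> E (Z (exp (i t (Z - 1)) - 1))\<close>, and
  the limit of the characteristic functions is that of the compound Poisson law.

  The degree differs from \<open>L\<close> only if two of the sets share \<open>w\<^sub>1\<close> and a further point. For sets of
  sizes \<open>k\<close> and \<open>l\<close> this has probability at most \<open>(k / m) (l / m) min 1 (k l / m)\<close>, and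
  \<open>min 1 x \<le> x\<^bsup>1/3\<^esup>\<close> turns the sum over pairs into
  \<open>(n / m)\<^sup>2 (E X\<^sub>1\<^bsup>4/3\<^esup>)\<^sup>2 m\<^bsup>-1/3\<^esup>\<close>, which tends to \<open>0\<close>.
\<close>

section \<open>Laws on the natural numbers\<close>

text \<open>On a countable type almost every point carries positive mass, so the law is discrete.
  Passing to a \<open>pmf\<close> turns expectations of \<open>Z\<close> and of \<open>Zt i\<close>
  into series over their masses.\<close>

lemma (in prob_space) law_as_pmf:
  fixes X :: "'a \<Rightarrow> 'b::countable"
  assumes X [measurable]: "X \<in> measurable M (count_space UNIV)"
  obtains p where "measure_pmf p = distr M (count_space UNIV) X" "\<And>k. pmf p k = \<P>(\<omega> in M. X \<omega> = k)"
proof -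
  interpret D: prob_space "distr M (count_space UNIV) X"
    by (rule prob_space_distr) simp
  have "AE x in distr M (count_space UNIV) X. measure (distr M (count_space UNIV) X) {x} \<noteq> 0"
    by (rule iffD2[OF D.AE_support_countable]) (auto intro!: exI[of _ UNIV] countableI_type)
  then have p: "measure_pmf (Abs_pmf (distr M (count_space UNIV) X)) = distr M (count_space UNIV) X"
    by (intro Abs_pmf_inverse) (auto intro: D.prob_space_axioms)
  show thesis
  proof (rule that[OF p])
    fix k
    show "pmf (Abs_pmf (distr M (count_space UNIV) X)) k = \<P>(\<omega> in M. X \<omega> = k)"
      unfolding pmf.rep_eq p by (subst measure_distr) (auto intro!: arg_cong[where f = prob])
  qed
qed

text \<open>Expectations under varying laws become integrals over one fixed counting measure, where
  dominated convergence can be applied to the masses.\<close>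

lemma integral_measure_pmf_count_space:
  fixes f :: "'a \<Rightarrow> 'b::{banach, second_countable_topology}"
  shows "(\<integral>x. f x \<partial>measure_pmf p) = (\<integral>x. pmf p x *\<^sub>R f x \<partial>count_space UNIV)"
  unfolding measure_pmf_eq_density by (subst integral_density) auto

lemma integrable_measure_pmf_count_space:
  fixes f :: "'a \<Rightarrow> 'b::{banach, second_countable_topology}"
  shows "integrable (measure_pmf p) f \<longleftrightarrow> integrable (count_space UNIV) (\<lambda>x. pmf p x *\<^sub>R f x)"
  unfolding measure_pmf_eq_density by (subst integrable_density) auto

lemma sums_measure_pmf_nat:
  fixes f :: "nat \<Rightarrow> 'b::{banach, second_countable_topology}"
  assumes "integrable (measure_pmf p) f"
  shows "(\<lambda>k. pmf p k *\<^sub>R f k) sums (\<integral>x. f x \<partial>measure_pmf p)"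
  using assms unfolding integrable_measure_pmf_count_space integral_measure_pmf_count_space
  by (rule sums_integral_count_space_nat)

text \<open>
  Scheffe's argument: convergence of the masses together with convergence of the means forces
  \<open>\<Sum>k. k * \<bar>pmf (p i) k - pmf q k\<bar> \<longlonglongrightarrow> 0\<close>.
\<close>

lemma tendsto_size_biased_expectation:
  fixes p :: "nat \<Rightarrow> nat pmf" and f :: "nat \<Rightarrow> 'b::{real_normed_algebra_1, banach, second_countable_topology}"
  assumes lim: "\<And>k. (\<lambda>i. pmf (p i) k) \<longlonglongrightarrow> pmf q k"
    and int_p: "\<And>i. integrable (measure_pmf (p i)) real"
    and int_q: "integrable (measure_pmf q) real"
    and E: "(\<lambda>i. measure_pmf.expectation (p i) real) \<longlonglongrightarrow> measure_pmf.expectation q real"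
    and bound: "\<And>k. norm (f k) \<le> B"
  shows "(\<lambda>i. measure_pmf.expectation (p i) (\<lambda>k. of_nat k * f k))
           \<longlonglongrightarrow> measure_pmf.expectation q (\<lambda>k. of_nat k * f k)"
proof -
  let ?C = "count_space (UNIV :: nat set)"
  define F where "F i k = pmf (p i) k * real k" for i k
  define G where "G k = pmf q k * real k" for k
  have intF: "integrable ?C (F i)" for i
    using int_p[of i] unfolding integrable_measure_pmf_count_space F_def by simp
  have intG: "integrable ?C G"
    using int_q unfolding integrable_measure_pmf_count_space G_def by simp
  have EF: "measure_pmf.expectation (p i) real = (\<integral>k. F i k \<partial>?C)" for i
    unfolding integral_measure_pmf_count_space F_def by simp
  have EG: "measure_pmf.expectation q real = (\<integral>k. G k \<partial>?C)"
    unfolding integral_measure_pmf_count_space G_def by simp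
  have nn: "F i k \<ge> 0" "G k \<ge> 0" for i k
    by (auto simp: F_def G_def)
  have B: "B \<ge> 0"
    using bound[of 0] norm_ge_zero order_trans by blast
  \<comment> \<open>The positive part of \<open>G - F i\<close> has the majorant \<open>G\<close>,
    which does not depend on \<open>i\<close>; the excess of \<open>F i\<close> over
    \<open>G\<close> is controlled afterwards through the means.\<close>
  have dom: "(\<lambda>i. \<integral>k. max 0 (G k - F i k) \<partial>?C) \<longlonglongrightarrow> (\<integral>k. 0 \<partial>?C)"
  proof (rule integral_dominated_convergence[where w = G])
    show "AE k in ?C. (\<lambda>i. max 0 (G k - F i k)) \<longlonglongrightarrow> 0"
    proof (rule AE_I2)
      fix k
      have "(\<lambda>i. max 0 (G k - F i k)) \<longlonglongrightarrow> max 0 (G k - G k)"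
        unfolding F_def G_def by (intro tendsto_intros lim)
      then show "(\<lambda>i. max 0 (G k - F i k)) \<longlonglongrightarrow> 0" by simp
    qed
  qed (use intG nn in \<open>auto simp: max_def\<close>)
  \<comment> \<open>From \<open>\<bar>x - y\<bar> = (x - y) + 2 * max 0 (y - x)\<close>: the first
    part integrates to the difference of the means, which tends to 0 by \<open>E\<close>.\<close>
  have abs_eq: "(\<integral>k. \<bar>F i k - G k\<bar> \<partial>?C) =
      (\<integral>k. F i k \<partial>?C) - (\<integral>k. G k \<partial>?C) + 2 * (\<integral>k. max 0 (G k - F i k) \<partial>?C)" for i
  proof -
    have "(\<integral>k. \<bar>F i k - G k\<bar> \<partial>?C) = (\<integral>k. (F i k - G k) + 2 * max 0 (G k - F i k) \<partial>?C)"
      by (intro Bochner_Integration.integral_cong) (auto simp: max_def)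
    also have "\<dots> = (\<integral>k. F i k \<partial>?C) - (\<integral>k. G k \<partial>?C) + 2 * (\<integral>k. max 0 (G k - F i k) \<partial>?C)"
      using intF[of i] intG by simp
    finally show ?thesis .
  qed
  have L1: "(\<lambda>i. \<integral>k. \<bar>F i k - G k\<bar> \<partial>?C) \<longlonglongrightarrow> 0"
  proof -
    have "(\<lambda>i. (\<integral>k. F i k \<partial>?C) - (\<integral>k. G k \<partial>?C) + 2 * (\<integral>k. max 0 (G k - F i k) \<partial>?C))
        \<longlonglongrightarrow> (\<integral>k. G k \<partial>?C) - (\<integral>k. G k \<partial>?C) + 2 * (\<integral>k. 0 \<partial>?C)"
      by (intro tendsto_intros dom) (use E in \<open>simp only: EF EG\<close>)
    then show ?thesis
      unfolding abs_eq by simp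
  qed
  have le: "F i k * norm (f k) \<le> B * F i k" "G k * norm (f k) \<le> B * G k" for i k
    using mult_left_mono[OF bound[of k] nn(1)[of i k]] mult_left_mono[OF bound[of k] nn(2)[of k]]
    by (simp_all add: mult.commute)
  have intFf: "integrable ?C (\<lambda>k. F i k *\<^sub>R f k)" for i
    by (rule Bochner_Integration.integrable_bound[where f = "\<lambda>k. B * F i k"])
       (use intF nn le B in auto)
  have intGf: "integrable ?C (\<lambda>k. G k *\<^sub>R f k)"
    by (rule Bochner_Integration.integrable_bound[where f = "\<lambda>k. B * G k"])
       (use intG nn le B in auto)
  have scale: "pmf r k *\<^sub>R (of_nat k * f k) = (pmf r k * real k) *\<^sub>R f k" for r k
    by (simp add: scaleR_conv_of_real mult.assoc)
  have le_diff: "\<bar>F i k - G k\<bar> * norm (f k) \<le> B * \<bar>F i k - G k\<bar>" for i k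
    using mult_left_mono[OF bound[of k] abs_ge_zero[of "F i k - G k"]] by (simp add: mult.commute)
  have diff: "norm ((\<integral>k. F i k *\<^sub>R f k \<partial>?C) - (\<integral>k. G k *\<^sub>R f k \<partial>?C)) \<le> B * (\<integral>k. \<bar>F i k - G k\<bar> \<partial>?C)" for i
  proof -
    have int: "integrable ?C (\<lambda>k. (F i k - G k) *\<^sub>R f k)"
      using intFf[of i] intGf by (simp add: scaleR_diff_left)
    have "(\<integral>k. F i k *\<^sub>R f k \<partial>?C) - (\<integral>k. G k *\<^sub>R f k \<partial>?C) = (\<integral>k. (F i k - G k) *\<^sub>R f k \<partial>?C)"
      using intFf[of i] intGf by (simp add: scaleR_diff_left)
    also have "norm \<dots> \<le> (\<integral>k. norm ((F i k - G k) *\<^sub>R f k) \<partial>?C)"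
      by (rule integral_norm_bound)
    also have "\<dots> \<le> (\<integral>k. B * \<bar>F i k - G k\<bar> \<partial>?C)"
      by (rule integral_mono)
         (use intF intG integrable_norm[OF int] le_diff in auto)
    finally show ?thesis by simp
  qed
  have "(\<lambda>i. (\<integral>k. F i k *\<^sub>R f k \<partial>?C) - (\<integral>k. G k *\<^sub>R f k \<partial>?C)) \<longlonglongrightarrow> 0"
    by (rule Lim_null_comparison[where g = "\<lambda>i. B * (\<integral>k. \<bar>F i k - G k\<bar> \<partial>?C)"])
       (use diff tendsto_mult_right_zero[OF L1, of B] in auto)
  then have "(\<lambda>i. \<integral>k. F i k *\<^sub>R f k \<partial>?C) \<longlonglongrightarrow> (\<integral>k. G k *\<^sub>R f k \<partial>?C)"
    by (simp add: LIM_zero_iff)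
  then show ?thesis
    unfolding integral_measure_pmf_count_space scale F_def G_def .
qed

lemma real_distribution_real_law:
  assumes "prob_space M" "X \<in> measurable M (count_space UNIV)"
  shows "real_distribution (real_law M X)"
  unfolding real_law_def
  by (rule prob_space.real_distribution_distr[OF assms(1)]) (use assms(2) in measurable)

lemma cdf_real_law_pmf: "cdf (real_law (measure_pmf p) (\<lambda>x. x)) a = measure_pmf.prob p {k. real k \<le> a}"
  unfolding cdf_def real_law_def by (subst measure_distr) (auto simp: vimage_def)

text \<open>Half-integers are continuity points of the limit cdf, and the mass at \<open>k\<close>
  is the increment of the cdf from \<open>k - 1/2\<close> to \<open>k + 1/2\<close>.\<close>

lemma weak_conv_m_real_law_pmf:
  fixes p :: "nat \<Rightarrow> nat pmf"
  assumes "weak_conv_m (\<lambda>i. real_law (measure_pmf (p i)) (\<lambda>x. x)) (real_law (measure_pmf q) (\<lambda>x. x))"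
  shows "(\<lambda>i. pmf (p i) k) \<longlonglongrightarrow> pmf q k"
proof -
  let ?F = "\<lambda>r. cdf (real_law (measure_pmf r) (\<lambda>x. x))"
  interpret Q: real_distribution "real_law (measure_pmf q) (\<lambda>x. x)"
    by (rule real_distribution_real_law) (auto intro: measure_pmf.prob_space_axioms)
  \<comment> \<open>\<open>j\<close> ranges over the integers because the mass at 0 requires the
    point -1/2.\<close>
  have conv: "(\<lambda>i. ?F (p i) (real_of_int j + 1/2)) \<longlonglongrightarrow> ?F q (real_of_int j + 1/2)" for j
  proof -
    have "real x \<noteq> real_of_int j + 1/2" for x :: nat
    proof
      assume "real x = real_of_int j + 1/2"
      then have "real_of_int (2 * int x) = real_of_int (2 * j + 1)" by simp
      then have "2 * int x = 2 * j + 1" by (simp only: of_int_eq_iff)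
      then show False by presburger
    qed
    then have "measure (real_law (measure_pmf q) (\<lambda>x. x)) {real_of_int j + 1/2} = 0"
      unfolding real_law_def by (subst measure_distr) (auto simp: vimage_def)
    then have "isCont (?F q) (real_of_int j + 1/2)"
      by (simp add: Q.isCont_cdf)
    then show ?thesis
      using assms unfolding weak_conv_m_def weak_conv_def by blast
  qed
  have pmf_eq: "pmf r k = ?F r (real_of_int (int k) + 1/2) - ?F r (real_of_int (int k - 1) + 1/2)" for r
  proof -
    have "{l. real l \<le> real_of_int (int k) + 1/2} = insert k {l. real l \<le> real_of_int (int k - 1) + 1/2}"
      by auto
    moreover have "k \<notin> {l. real l \<le> real_of_int (int k - 1) + 1/2}"
      by auto
    ultimately show ?thesis
      unfolding cdf_real_law_pmf
      using measure_pmf.finite_measure_Union[of "{k}" r "{l. real l \<le> real_of_int (int k - 1) + 1/2}"]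
      by (simp add: measure_pmf_single)
  qed
  show ?thesis
    unfolding pmf_eq by (intro tendsto_diff conv)
qed

section \<open>Characteristic functions\<close>

text \<open>Both \<open>exp (z i)\<close> and \<open>1 + z i\<close> lie in the closed unit disc, so
  their powers of exponent \<open>n i\<close> differ by at most \<open>n i\<close> times the
  distance of the bases. That product tends to 0, since \<open>exp x - 1 - x\<close> is of smaller
  order than \<open>x\<close> and \<open>n i * z i\<close> converges.\<close>

lemma tendsto_one_plus_power_exp:
  fixes z :: "nat \<Rightarrow> complex"
  assumes lim: "(\<lambda>i. of_nat (n i) * z i) \<longlonglongrightarrow> w" and n: "filterlim n at_top sequentially"
    and bound: "\<And>i. norm (1 + z i) \<le> 1" and Re: "\<And>i. Re (z i) \<le> 0"
  shows "(\<lambda>i. (1 + z i) ^ n i) \<longlonglongrightarrow> exp w"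
proof -
  have n': "filterlim (\<lambda>i. real (n i)) at_top sequentially"
    by (rule filterlim_compose[OF filterlim_real_sequentially n])
  have n0: "\<forall>\<^sub>F i in sequentially. n i > 0"
    using n by (metis eventually_gt_at_top filterlim_iff)
  \<comment> \<open>Dividing the convergent sequence \<open>n i * z i\<close> by \<open>n i\<close>,
    which tends to infinity, gives \<open>z i\<close> as soon as \<open>n i > 0\<close>.\<close>
  have "(\<lambda>i. complex_of_real (inverse (real (n i))) * (of_nat (n i) * z i)) \<longlonglongrightarrow> of_real 0 * w"
    by (intro tendsto_mult lim tendsto_of_real tendsto_inverse_0_at_top[OF n'])
  then have "(\<lambda>i. complex_of_real (inverse (real (n i))) * (of_nat (n i) * z i)) \<longlonglongrightarrow> 0"
    by simp
  then have z0: "z \<longlonglongrightarrow> 0"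
    by (rule Lim_transform_eventually) (use n0 in \<open>auto elim!: eventually_mono\<close>)
  \<comment> \<open>The limit is the derivative of \<open>exp\<close> at 0 minus 1. The value 0 at
    \<open>x = 0\<close> makes the quotient continuous there, so indices with \<open>z i = 0\<close>
    are covered.\<close>
  have quot: "((\<lambda>x::complex. if x = 0 then 0 else (exp x - 1 - x) / x) \<longlongrightarrow> 0) (at 0)"
  proof -
    have "((\<lambda>x::complex. (exp x - exp 0 ) / (x - 0)) \<longlongrightarrow> 1) (at 0)"
      using DERIV_exp[of "0::complex"] unfolding has_field_derivative_iff by simp
    then have "((\<lambda>x::complex. (exp x - exp 0 ) / (x - 0) - 1) \<longlongrightarrow> 0) (at 0)"
      by (auto intro: tendsto_eq_intros)
    then show ?thesis
      by (rule Lim_transform_eventually) (auto simp: eventually_at_filter field_simps)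
  qed
  have "(\<lambda>i. if z i = 0 then 0 else (exp (z i) - 1 - z i) / z i) \<longlonglongrightarrow> 0"
    by (rule isCont_tendsto_compose[OF _ z0, of "\<lambda>x. if x = 0 then 0 else (exp x - 1 - x) / x", simplified])
       (use quot in \<open>simp add: isCont_def\<close>)
  then have "(\<lambda>i. (of_nat (n i) * z i) * (if z i = 0 then 0 else (exp (z i) - 1 - z i) / z i)) \<longlonglongrightarrow> w * 0"
    by (intro tendsto_mult lim)
  moreover have "(of_nat (n i) * z i) * (if z i = 0 then 0 else (exp (z i) - 1 - z i) / z i)
      = of_nat (n i) * (exp (z i) - (1 + z i))" for i
    by auto
  ultimately have "(\<lambda>i. of_nat (n i) * (exp (z i) - (1 + z i))) \<longlonglongrightarrow> 0"
    by simp
  then have "(\<lambda>i. real (n i) * norm (exp (z i) - (1 + z i))) \<longlonglongrightarrow> 0"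
    using tendsto_norm_zero by (fastforce simp: norm_mult)
  then have "(\<lambda>i. exp (z i) ^ n i - (1 + z i) ^ n i) \<longlonglongrightarrow> 0"
    by (rule Lim_null_comparison[rotated])
       (use bound Re in \<open>auto intro!: always_eventually norm_power_diff simp: norm_exp_eq_Re\<close>)
  moreover have "(\<lambda>i. exp (z i) ^ n i) \<longlonglongrightarrow> exp w"
    using tendsto_exp[OF lim] by (simp add: exp_of_nat_mult)
  ultimately have "(\<lambda>i. exp (z i) ^ n i - (exp (z i) ^ n i - (1 + z i) ^ n i)) \<longlonglongrightarrow> exp w - 0"
    by (intro tendsto_diff)
  then show ?thesis by simp
qed

text \<open>Lets the index 0 be dropped: the random graphs are given only for m \<ge> 1.\<close>

lemma weak_conv_m_SucI: "weak_conv_m (\<lambda>i. F (Suc i)) G \<Longrightarrow> weak_conv_m F G"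
  unfolding weak_conv_m_def weak_conv_def by (blast intro: LIMSEQ_imp_Suc)

text \<open>Independence of \<open>\<Lambda>\<close> and the sequence \<open>Zt\<close> is given
  through generated sigma-algebras. Functions measurable with respect to these generate smaller
  sigma-algebras and so inherit the independence.\<close>

lemma (in prob_space) indep_var_of_indep_set:
  assumes ind: "indep_set (sets A) (sets B)"
    and sp: "space A = space M" "space B = space M"
    and X: "X \<in> measurable A N" and Y: "Y \<in> measurable B K"
  shows "indep_var N X K Y"
proof -
  have rv: "Z \<in> measurable M L" if "sets C \<subseteq> events" "space C = space M" "Z \<in> measurable C L" for C Z L
    using that by (auto simp: measurable_def)
  have sub: "sigma_sets (space M) {Z -` E \<inter> space M | E. E \<in> sets L} \<subseteq> sets C"
    if "space C = space M" "Z \<in> measurable C L" for C Z L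
  proof -
    have "{Z -` E \<inter> space C | E. E \<in> sets L} \<subseteq> sets C"
      using that(2) by (auto intro: measurable_sets)
    from sets.sigma_sets_subset[OF this] show ?thesis
      by (simp only: that(1))
  qed
  show ?thesis
    unfolding indep_var_eq
  proof (intro conjI)
    show "random_variable N X" "random_variable K Y"
      using rv[OF indep_setD_ev1[OF ind] sp(1) X] rv[OF indep_setD_ev2[OF ind] sp(2) Y] by auto
    show "indep_set (sigma_sets (space M) {X -` A \<inter> space M |A. A \<in> sets N})
        (sigma_sets (space M) {Y -` A \<inter> space M |A. A \<in> sets K})"
      using ind sub[OF sp(1) X] sub[OF sp(2) Y] unfolding indep_set_def
      by (elim indep_sets_mono_sets) (auto split: bool.split)
  qed
qed

lemma char_real_law:
  assumes "X \<in> measurable M (count_space UNIV)"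
  shows "char (real_law M X) t = (\<integral>\<omega>. iexp (t * real (X \<omega>)) \<partial>M)"
  unfolding char_def real_law_def by (subst integral_distr) (use assms in measurable)

section \<open>Characteristic function of the compound Poisson law\<close>

context compound_poisson
begin

lemma measurable_Zt: "i \<ge> 1 \<Longrightarrow> Zt i \<in> measurable S (count_space UNIV)"
  using indep_Zt by (auto simp: indep_vars_def)

text \<open>The number of summands is random, so measurability comes from splitting over the
  countably many values of \<open>\<Lambda>\<close>.\<close>

lemma measurable_random_sum: "random_sum \<Lambda> Zt \<in> measurable S (count_space UNIV)"
proof -
  have "(\<lambda>\<omega>. \<Sum>j\<in>{1..k}. Zt j \<omega>) \<in> measurable S (count_space UNIV)" for k
    by (rule measurable_sum_nat) (auto intro: measurable_Zt)
  then have "(\<lambda>\<omega>. (\<lambda>k \<omega>. \<Sum>j\<in>{1..k}. Zt j \<omega>) (\<Lambda> \<omega>) \<omega>) \<in> measurable S (count_space UNIV)"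
    by (rule measurable_compose_countable[OF _ measurable_\<Lambda>])
  then show ?thesis
    by (simp add: random_sum_def[abs_def])
qed

text \<open>The series depends on the masses \<open>q\<close> and not on \<open>i\<close>, hence all
  \<open>Zt i\<close> share one characteristic function.\<close>

lemma char_real_law_Zt:
  assumes "i \<ge> 1"
  shows "(\<lambda>j. q j *\<^sub>R iexp (t * real j)) sums char (real_law S (Zt i)) t"
proof -
  note [measurable] = measurable_Zt[OF assms]
  obtain p where p: "measure_pmf p = distr S (count_space UNIV) (Zt i)"
      "\<And>k. pmf p k = \<P>(\<omega> in S. Zt i \<omega> = k)"
    using law_as_pmf[OF measurable_Zt[OF assms]] by blast
  have "(\<lambda>j. pmf p j *\<^sub>R iexp (t * real j)) sums (\<integral>k. iexp (t * real k) \<partial>measure_pmf p)"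
    by (intro sums_measure_pmf_nat measure_pmf.integrable_const_bound[where B = 1]) auto
  moreover have "(\<integral>k. iexp (t * real k) \<partial>measure_pmf p) = char (real_law S (Zt i)) t"
    unfolding p(1) char_real_law[OF measurable_Zt[OF assms]] by (subst integral_distr) auto
  ultimately show ?thesis
    using assms by (simp add: p(2) prob_Zt)
qed

lemma char_partial_sum:
  "(\<integral>\<omega>. iexp (t * real (\<Sum>j\<in>{1..k}. Zt j \<omega>)) \<partial>S) = char (real_law S (Zt 1)) t ^ k"
proof -
  have ind: "indep_vars (\<lambda>_. borel) (\<lambda>j \<omega>. real (Zt j \<omega>)) {1..k}"
    by (rule indep_vars_compose2[OF indep_vars_subset[OF indep_Zt]]) auto
  have "(\<integral>\<omega>. iexp (t * real (\<Sum>j\<in>{1..k}. Zt j \<omega>)) \<partial>S)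
      = char (real_law S (\<lambda>\<omega>. \<Sum>j\<in>{1..k}. Zt j \<omega>)) t"
    by (rule char_real_law[symmetric], rule measurable_sum_nat) (auto intro: measurable_Zt)
  also have "\<dots> = char (distr S borel (\<lambda>\<omega>. \<Sum>j\<in>{1..k}. real (Zt j \<omega>))) t"
    by (simp add: real_law_def)
  also have "\<dots> = (\<Prod>j\<in>{1..k}. char (distr S borel (\<lambda>\<omega>. real (Zt j \<omega>))) t)"
    by (rule char_distr_sum[OF ind])
  also have "\<dots> = (\<Prod>j\<in>{1..k}. char (real_law S (Zt 1)) t)"
    by (intro prod.cong refl, fold real_law_def) (auto intro!: sums_unique2[OF char_real_law_Zt char_real_law_Zt])
  finally show ?thesis by simp
qed

text \<open>Splitting by the value \<open>k\<close> of \<open>\<Lambda>\<close> yields Poisson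
  weights times \<open>k\<close>-th powers of the characteristic function of \<open>Zt 1\<close>,
  which is an exponential series.\<close>

lemma char_random_sum:
  "char (real_law S (random_sum \<Lambda> Zt)) t = exp (of_real rate * (char (real_law S (Zt 1)) t - 1))"
proof -
  let ?\<psi> = "char (real_law S (Zt 1)) t"
  \<comment> \<open>\<open>U k\<close> selects the event that \<open>\<Lambda>\<close> equals
    \<open>k\<close>, and \<open>V k\<close> is the exponential of the \<open>k\<close>-th partial
    sum; the products \<open>U k * V k\<close> add up to the exponential of the random sum.\<close>
  define V where "V k \<omega> = iexp (t * real (\<Sum>j\<in>{1..k}. Zt j \<omega>))" for k \<omega>
  define U where "U k \<omega> = (indicator {k} (\<Lambda> \<omega>) :: complex)" for k \<omega>
  note [measurable] = measurable_\<Lambda>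
  have [measurable]: "V k \<in> borel_measurable S" for k
  proof -
    have "(\<lambda>\<omega>. \<Sum>j\<in>{1..k}. Zt j \<omega>) \<in> measurable S (count_space UNIV)"
      by (rule measurable_sum_nat) (auto intro: measurable_Zt)
    then show ?thesis
      unfolding V_def[abs_def] by measurable
  qed
  have [measurable]: "U k \<in> borel_measurable S" for k
    unfolding U_def[abs_def] by (rule measurable_compose[OF measurable_\<Lambda>]) simp
  have normV: "norm (V k \<omega>) = 1" for k \<omega>
    by (simp add: V_def del: of_nat_sum)
  have normU: "norm (U k \<omega>) = indicator {\<omega> \<in> space S. \<Lambda> \<omega> = k} \<omega>" if "\<omega> \<in> space S" for k \<omega>
    using that by (simp add: U_def indicator_def)
  have UV: "indep_var borel (U k) borel (V k)" for k
  proof (rule indep_var_of_indep_set[OF indep_\<Lambda>_Zt])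
    have "\<Lambda> \<in> measurable (vimage_algebra (space S) \<Lambda> (count_space UNIV)) (count_space UNIV)"
      by (rule measurable_vimage_algebra1) auto
    then show "U k \<in> borel_measurable (vimage_algebra (space S) \<Lambda> (count_space UNIV))"
      unfolding U_def[abs_def] by (rule measurable_compose) simp
    let ?Z = "\<lambda>\<omega>. \<lambda>i\<in>{1..}. Zt i \<omega>" and ?\<Pi> = "\<Pi>\<^sub>M i\<in>{1..}. count_space (UNIV :: nat set)"
    have 1: "?Z \<in> measurable (vimage_algebra (space S) ?Z ?\<Pi>) ?\<Pi>"
      by (rule measurable_vimage_algebra1) (auto simp: space_PiM)
    have "(\<lambda>x :: nat \<Rightarrow> nat. \<Sum>j\<in>{1..k}. x j) \<in> measurable ?\<Pi> (count_space UNIV)"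
      by (rule measurable_sum_nat) (auto intro: measurable_component_singleton)
    then have "(\<lambda>x. iexp (t * real (\<Sum>j\<in>{1..k}. x j))) \<in> borel_measurable ?\<Pi>"
      by measurable
    from measurable_compose[OF 1 this]
    show "V k \<in> borel_measurable (vimage_algebra (space S) ?Z ?\<Pi>)"
      by (simp add: V_def[abs_def])
  qed simp_all
  have intU: "integrable S (U k)" and intV: "integrable S (V k)" for k
    by (auto intro!: integrable_const_bound[where B = 1] simp: normV U_def split: split_indicator)
  have EU: "(\<integral>\<omega>. U k \<omega> \<partial>S) = of_real (rate ^ k / fact k * exp (- rate))" for k
  proof -
    have "(\<integral>\<omega>. U k \<omega> \<partial>S) = (\<integral>\<omega>. of_real (indicator {\<omega> \<in> space S. \<Lambda> \<omega> = k} \<omega>) \<partial>S)"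
      by (intro Bochner_Integration.integral_cong) (auto simp: U_def indicator_def)
    also have "\<dots> = of_real (prob {\<omega> \<in> space S. \<Lambda> \<omega> = k})"
      by (subst integral_complex_of_real) simp
    finally show ?thesis
      by (simp add: prob_\<Lambda>)
  qed
  have EUV: "(\<integral>\<omega>. U k \<omega> * V k \<omega> \<partial>S) = of_real (rate ^ k / fact k * exp (- rate)) * ?\<psi> ^ k" for k
    using indep_var_lebesgue_integral[OF UV intU intV, of k] EU[of k] char_partial_sum[of t k]
    by (simp add: V_def)
  have exp_sums: "(\<lambda>k. rate ^ k / fact k * exp (- rate)) sums (exp rate * exp (- rate))"
    using exp_converges[of rate] by (intro sums_mult2) (simp add: field_simps)
  \<comment> \<open>Sum and integral may be exchanged because
    \<open>norm (U k \<omega> * V k \<omega>)\<close> is the indicator of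
    \<open>\<Lambda> \<omega> = k\<close>; its integral is a Poisson mass, and these masses are
    summable.\<close>
  have "(\<lambda>k. \<integral>\<omega>. U k \<omega> * V k \<omega> \<partial>S) sums (\<integral>\<omega>. (\<Sum>k. U k \<omega> * V k \<omega>) \<partial>S)"
  proof (rule sums_integral)
    show "integrable S (\<lambda>\<omega>. U k \<omega> * V k \<omega>)" for k
      by (rule indep_var_integrable[OF UV intU intV])
    show "AE \<omega> in S. summable (\<lambda>k. norm (U k \<omega> * V k \<omega>))"
    proof (rule AE_I2)
      fix \<omega>
      show "summable (\<lambda>k. norm (U k \<omega> * V k \<omega>))"
        by (rule summable_finite[of "{\<Lambda> \<omega>}"]) (auto simp: U_def)
    qed
    have "(\<integral>\<omega>. norm (U k \<omega> * V k \<omega>) \<partial>S) = rate ^ k / fact k * exp (- rate)" for k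
    proof -
      have "(\<integral>\<omega>. norm (U k \<omega> * V k \<omega>) \<partial>S) = (\<integral>\<omega>. indicator {\<omega> \<in> space S. \<Lambda> \<omega> = k} \<omega> \<partial>S)"
        by (intro Bochner_Integration.integral_cong) (auto simp: norm_mult normV normU)
      then show ?thesis
        by (simp add: prob_\<Lambda>)
    qed
    then show "summable (\<lambda>k. \<integral>\<omega>. norm (U k \<omega> * V k \<omega>) \<partial>S)"
      using exp_sums by (simp add: sums_iff)
  qed
  moreover have "(\<Sum>k. U k \<omega> * V k \<omega>) = iexp (t * real (random_sum \<Lambda> Zt \<omega>))" for \<omega>
    by (subst suminf_finite[of "{\<Lambda> \<omega>}"]) (auto simp: U_def V_def random_sum_def)
  ultimately have 1: "(\<lambda>k. of_real (rate ^ k / fact k * exp (- rate)) * ?\<psi> ^ k)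
      sums char (real_law S (random_sum \<Lambda> Zt)) t"
    by (simp only: EUV char_real_law[OF measurable_random_sum])
  have "(\<lambda>k. of_real (exp (- rate)) * ((of_real rate * ?\<psi>) ^ k /\<^sub>R fact k))
      sums (of_real (exp (- rate)) * exp (of_real rate * ?\<psi>))"
    by (intro sums_mult exp_converges)
  moreover have "of_real (exp (- rate)) * ((of_real rate * ?\<psi>) ^ k /\<^sub>R fact k)
      = of_real (rate ^ k / fact k * exp (- rate)) * ?\<psi> ^ k" for k
    by (simp add: scaleR_conv_of_real power_mult_distrib field_simps)
  ultimately have 2: "(\<lambda>k. of_real (rate ^ k / fact k * exp (- rate)) * ?\<psi> ^ k)
      sums (of_real (exp (- rate)) * exp (of_real rate * ?\<psi>))"
    by simp
  have "of_real (exp (- rate)) * exp (of_real rate * ?\<psi>) = exp (of_real rate * (?\<psi> - 1))"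
    by (simp add: exp_of_real[symmetric] exp_add[symmetric] algebra_simps del: exp_of_real)
  with sums_unique2[OF 1 2] show ?thesis by simp
qed

end

text \<open>The mean of \<open>Z\<close> in the Poisson rate cancels the normalisation of the
  size-biased masses. What remains is the series of
  \<open>(j + 1) * pmf p (j + 1) * (exp (i t j) - 1)\<close>, an expectation under \<open>p\<close>
  after the substitution \<open>k = j + 1\<close>.\<close>

lemma char_compound_poisson_size_biased:
  assumes "prob_space N" and Z: "Z \<in> measurable N (count_space UNIV)"
    and p: "measure_pmf p = distr N (count_space UNIV) Z" "\<And>k. pmf p k = \<P>(\<omega> in N. Z \<omega> = k)"
    and int: "integrable N (\<lambda>\<omega>. real (Z \<omega>))"
    and cp: "compound_poisson S ((\<integral>\<omega>. real (Z \<omega>) \<partial>N) / \<beta>) (size_biased_mass N Z) \<Lambda> Zt"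
  shows "char (real_law S (random_sum \<Lambda> Zt)) t =
    exp (of_real (1 / \<beta>) * measure_pmf.expectation p (\<lambda>k. of_nat k * (iexp (t * real (k - 1)) - 1)))"
proof -
  interpret cp: compound_poisson S "(\<integral>\<omega>. real (Z \<omega>) \<partial>N) / \<beta>" "size_biased_mass N Z" \<Lambda> Zt
    by (rule cp)
  note [measurable] = Z
  define f where "f k = iexp (t * real (k - 1)) - 1" for k
  define \<mu> where "\<mu> = (\<integral>\<omega>. real (Z \<omega>) \<partial>N)"
  have \<mu>: "measure_pmf.expectation p real = \<mu>" and int_p: "integrable (measure_pmf p) real"
    unfolding p(1) \<mu>_def using int by (auto simp: integral_distr integrable_distr_eq)
  have bound: "norm (f k) \<le> 2" for k
    unfolding f_def using norm_triangle_ineq4[of "iexp (t * real (k - 1))" 1] by simp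
  have int_f: "integrable (measure_pmf p) (\<lambda>k. of_nat k * f k)"
    by (rule Bochner_Integration.integrable_bound[where f = "\<lambda>k. 2 * real k"])
       (use int_p bound in \<open>auto simp: norm_mult mult.commute[of 2] intro!: mult_left_mono\<close>)
  have "of_real \<mu> * (char (real_law S (Zt 1)) t - 1) = measure_pmf.expectation p (\<lambda>k. of_nat k * f k)"
  proof (cases "\<mu> = 0")
    \<comment> \<open>Mean 0 puts all mass of \<open>p\<close> at 0, so both sides vanish whatever
      the law of \<open>Zt 1\<close> is.\<close>
    case True
    have "AE k in measure_pmf p. real k = 0"
      using True int_p by (subst integral_nonneg_eq_0_iff_AE[symmetric]) (auto simp: \<mu>)
    then have "measure_pmf.expectation p (\<lambda>k. of_nat k * f k) = measure_pmf.expectation p (\<lambda>k. 0)"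
      by (intro integral_cong_AE) (auto simp: AE_measure_pmf_iff)
    with True show ?thesis by simp
  next
    case False
    moreover have "\<mu> \<ge> 0"
      unfolding \<mu>_def by simp
    ultimately have pos: "\<mu> > 0" by simp
    have q: "size_biased_mass N Z j = real (j + 1) * pmf p (j + 1) / \<mu>" for j
      using pos unfolding size_biased_mass_def Let_def \<mu>_def[symmetric] p(2) by simp
    have "(\<lambda>k. pmf p k *\<^sub>R (of_nat k * f k)) sums measure_pmf.expectation p (\<lambda>k. of_nat k * f k)"
      by (rule sums_measure_pmf_nat[OF int_f])
    \<comment> \<open>The factor \<open>k\<close> kills the term at \<open>k = 0\<close>, so the
      shift of the index loses nothing, and \<open>k - 1\<close> becomes \<open>j\<close> without
      truncation.\<close>
    then have "(\<lambda>j. pmf p (Suc j) *\<^sub>R (of_nat (Suc j) * f (Suc j)))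
        sums measure_pmf.expectation p (\<lambda>k. of_nat k * f k)"
      using sums_Suc_iff[of "\<lambda>k. pmf p k *\<^sub>R (of_nat k * f k)" "measure_pmf.expectation p (\<lambda>k. of_nat k * f k)"]
      by (simp del: of_nat_Suc)
    \<comment> \<open>Subtracting the series at \<open>t = 0\<close>, where the characteristic
      function equals 1, supplies the \<open>- 1\<close> in \<open>f\<close>.\<close>
    moreover have "(\<lambda>j. \<mu> *\<^sub>R (size_biased_mass N Z j *\<^sub>R iexp (t * real j) - size_biased_mass N Z j *\<^sub>R iexp (0 * real j)))
        sums (\<mu> *\<^sub>R (char (real_law S (Zt 1)) t - char (real_law S (Zt 1)) 0))"
      by (intro sums_scaleR_right sums_diff cp.char_real_law_Zt) auto
    moreover have "\<mu> *\<^sub>R (size_biased_mass N Z j *\<^sub>R iexp (t * real j) - size_biased_mass N Z j *\<^sub>R iexp (0 * real j))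
        = pmf p (Suc j) *\<^sub>R (of_nat (Suc j) * f (Suc j))" for j
      using pos by (simp add: q f_def scaleR_conv_of_real field_simps)
    moreover have "char (real_law S (Zt 1)) 0 = 1"
      by (rule real_distribution.char_zero, rule real_distribution_real_law)
         (auto intro: cp.measurable_Zt cp.prob_space_axioms)
    ultimately show ?thesis
      by (simp add: sums_unique2 scaleR_conv_of_real)
  qed
  then show ?thesis
    unfolding cp.char_random_sum f_def[symmetric] \<mu>_def[symmetric] by (simp add: field_simps)
qed

section \<open>Subsets of a finite set\<close>

text \<open>A superset of \<open>T\<close> is determined by its part outside \<open>T\<close>, which
  may be any subset of \<open>V - T\<close> of the remaining size.\<close>

lemma card_supersets_of_card:
  assumes "finite V" "T \<subseteq> V" "card T \<le> k"
  shows "card {B. T \<subseteq> B \<and> B \<subseteq> V \<and> card B = k} = (card V - card T) choose (k - card T)"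
proof -
  have fin: "finite B" if "B \<subseteq> V" for B
    using that assms(1) finite_subset by blast
  have "bij_betw (\<lambda>B. B \<union> T) {C. C \<subseteq> V - T \<and> card C = k - card T} {B. T \<subseteq> B \<and> B \<subseteq> V \<and> card B = k}"
  proof (rule bij_betwI[where g = "\<lambda>B. B - T"])
    show "(\<lambda>B. B \<union> T) \<in> {C. C \<subseteq> V - T \<and> card C = k - card T} \<rightarrow> {B. T \<subseteq> B \<and> B \<subseteq> V \<and> card B = k}"
    proof
      fix C assume C: "C \<in> {C. C \<subseteq> V - T \<and> card C = k - card T}"
      then have "card (C \<union> T) = card C + card T"
        using assms fin by (intro card_Un_disjoint) auto
      then have "card (C \<union> T) = k"
        using C assms(3) by simp
      then show "C \<union> T \<in> {B. T \<subseteq> B \<and> B \<subseteq> V \<and> card B = k}"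
        using C assms(2) by blast
    qed
    show "(\<lambda>B. B - T) \<in> {B. T \<subseteq> B \<and> B \<subseteq> V \<and> card B = k} \<rightarrow> {C. C \<subseteq> V - T \<and> card C = k - card T}"
    proof
      fix B assume B: "B \<in> {B. T \<subseteq> B \<and> B \<subseteq> V \<and> card B = k}"
      then have "card (B - T) = k - card T"
        using fin[of T] assms(2) by (simp add: card_Diff_subset)
      with B show "B - T \<in> {C. C \<subseteq> V - T \<and> card C = k - card T}"
        by blast
    qed
  next
    show "C \<union> T - T = C" if "C \<in> {C. C \<subseteq> V - T \<and> card C = k - card T}" for C
    proof -
      from that have "C \<subseteq> V - T" by simp
      then show ?thesis by blast
    qed
    show "B - T \<union> T = B" if "B \<in> {B. T \<subseteq> B \<and> B \<subseteq> V \<and> card B = k}" for B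
    proof -
      from that have "T \<subseteq> B" by simp
      then show ?thesis by blast
    qed
  qed
  then have "card {B. T \<subseteq> B \<and> B \<subseteq> V \<and> card B = k} = card {C. C \<subseteq> V - T \<and> card C = k - card T}"
    by (rule bij_betw_same_card[symmetric])
  also have "\<dots> = card (V - T) choose (k - card T)"
    using assms by (intro n_subsets) simp
  also have "card (V - T) = card V - card T"
    using assms fin by (intro card_Diff_subset) auto
  finally show ?thesis .
qed

text \<open>Absorption \<open>k * (m choose k) = m * ((m - 1) choose (k - 1))\<close>. The ratio
  \<open>k / m\<close> is the chance that a uniform \<open>k\<close>-subset contains the point 1,
  and it is the source of the size biasing.\<close>

lemma card_subsets_containing:
  assumes "m \<ge> 1"
  shows "real (card {B. B \<subseteq> {1..m} \<and> 1 \<in> B \<and> card B = k}) = real k / real m * real (m choose k)"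
proof (cases "k = 0")
  case True
  have "{B. B \<subseteq> {1..m} \<and> 1 \<in> B \<and> card B = 0} = {}"
    by (auto simp: card_gt_0_iff intro: finite_subset)
  with True show ?thesis by simp
next
  case False
  have "{B. B \<subseteq> {1..m} \<and> 1 \<in> B \<and> card B = k} = {B. {1} \<subseteq> B \<and> B \<subseteq> {1..m} \<and> card B = k}"
    by auto
  then have "card {B. B \<subseteq> {1..m} \<and> 1 \<in> B \<and> card B = k} = (m - 1) choose (k - 1)"
    using card_supersets_of_card[of "{1..m}" "{1}" k] assms False by simp
  moreover have "real k * real (m choose k) = real m * real ((m - 1) choose (k - 1))"
    using times_binomial_minus1_eq[of k m] False by (simp flip: of_nat_mult)
  ultimately show ?thesis
    using assms by (simp add: field_simps)
qed

text \<open>Absorbing twice gives the exact ratio \<open>k (k - 1) / (m (m - 1))\<close>, and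
  \<open>(k - 1) / (m - 1) \<le> k / m\<close> because \<open>k \<le> m\<close>.\<close>

lemma card_subsets_containing2:
  assumes "v \<in> {1..m}" "v \<noteq> 1" "k \<le> m"
  shows "real (card {B. B \<subseteq> {1..m} \<and> 1 \<in> B \<and> v \<in> B \<and> card B = k})
    \<le> (real k / real m)\<^sup>2 * real (m choose k)"
proof (cases "k \<le> 1")
  case True
  have "card B \<noteq> k" if "B \<subseteq> {1..m}" "1 \<in> B" "v \<in> B" for B
  proof
    assume "card B = k"
    then have "card {1, v} \<le> k"
      using that by (metis card_mono empty_subsetI finite_atLeastAtMost finite_subset insert_subset)
    with assms True show False by simp
  qed
  then have "{B. B \<subseteq> {1..m} \<and> 1 \<in> B \<and> v \<in> B \<and> card B = k} = {}"
    by auto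
  then show ?thesis by (simp only: card.empty) simp
next
  case False
  have m: "m \<ge> 2" using assms by auto
  have "{B. B \<subseteq> {1..m} \<and> 1 \<in> B \<and> v \<in> B \<and> card B = k} = {B. {1, v} \<subseteq> B \<and> B \<subseteq> {1..m} \<and> card B = k}"
    by auto
  then have c: "card {B. B \<subseteq> {1..m} \<and> 1 \<in> B \<and> v \<in> B \<and> card B = k} = (m - 2) choose (k - 2)"
    using card_supersets_of_card[of "{1..m}" "{1, v}" k] assms False by (simp add: numeral_2_eq_2)
  have 1: "real k * real (m choose k) = real m * real ((m - 1) choose (k - 1))"
    using times_binomial_minus1_eq[of k m] False by (simp flip: of_nat_mult)
  have 2: "real (k - 1) * real ((m - 1) choose (k - 1)) = real (m - 1) * real ((m - 2) choose (k - 2))"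
  proof -
    have "(k - 1) * ((m - 1) choose (k - 1)) = (m - 1) * ((m - 2) choose (k - 2))"
      using times_binomial_minus1_eq[of "k - 1" "m - 1"] False by (simp add: numeral_2_eq_2)
    then show ?thesis by (simp only: of_nat_mult[symmetric])
  qed
  have "real (m - 1) \<noteq> 0" using m by simp
  then have "real ((m - 2) choose (k - 2)) = real (k - 1) / real (m - 1) * real ((m - 1) choose (k - 1))"
    unfolding times_divide_eq_left 2 by simp
  also have "real ((m - 1) choose (k - 1)) = real k / real m * real (m choose k)"
    using 1 m by (simp add: field_simps)
  finally have "real ((m - 2) choose (k - 2)) = real (k - 1) / real (m - 1) * (real k / real m) * real (m choose k)"
    by simp
  also have "\<dots> \<le> real k / real m * (real k / real m) * real (m choose k)"
  proof -
    have "real (k - 1) / real (m - 1) \<le> real k / real m"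
      using m False assms by (simp add: field_simps of_nat_diff)
    then show ?thesis by (intro mult_right_mono) auto
  qed
  finally show ?thesis
    unfolding c power2_eq_square .
qed

lemma le_powr_of_le_one:
  fixes x a :: real
  assumes "y \<le> 1" "y \<le> x" "0 \<le> x" "0 < a" "a \<le> 1"
  shows "y \<le> x powr a"
proof (cases "x \<ge> 1")
  case True
  then show ?thesis using ge_one_powr_ge_zero[of x a] assms by simp
next
  case False
  show ?thesis
  proof (cases "x = 0")
    case False
    then have "x powr 1 \<le> x powr a"
      using assms \<open>\<not> x \<ge> 1\<close> by (intro powr_mono') auto
    with assms False show ?thesis by simp
  qed (use assms in auto)
qed

text \<open>Two bounds are interpolated: one from the requirement \<open>1 \<in> B\<close> alone,
  the other from a union bound over the points \<open>v\<close> of \<open>A\<close>, which adds the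
  factor \<open>card A * k / m\<close>. The exponent 1/3 makes each set size enter the final
  estimate with the power 4/3.\<close>

lemma card_subsets_meeting:
  assumes "m \<ge> 1" "A \<subseteq> {1..m}" "k \<le> m"
  shows "real (card {B. B \<subseteq> {1..m} \<and> 1 \<in> B \<and> (\<exists>v\<in>A \<inter> B. v \<noteq> 1) \<and> card B = k})
    \<le> real k / real m * (real (card A) * real k / real m) powr (1/3) * real (m choose k)"
proof -
  let ?S = "{B. B \<subseteq> {1..m} \<and> 1 \<in> B \<and> (\<exists>v\<in>A \<inter> B. v \<noteq> 1) \<and> card B = k}"
  let ?c = "real k / real m * real (m choose k)"
  have fA: "finite A" using assms(2) finite_subset by blast
  have c: "?c \<ge> 0" by simp
  have "real (card ?S) \<le> real (card {B. B \<subseteq> {1..m} \<and> 1 \<in> B \<and> card B = k})"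
    by (intro of_nat_mono card_mono) auto
  then have 1: "real (card ?S) \<le> ?c"
    by (simp only: card_subsets_containing[OF assms(1)])
  have "?S = (\<Union>v\<in>A - {1}. {B. B \<subseteq> {1..m} \<and> 1 \<in> B \<and> v \<in> B \<and> card B = k})"
    by auto
  then have "real (card ?S) \<le> (\<Sum>v\<in>A - {1}. real (card {B. B \<subseteq> {1..m} \<and> 1 \<in> B \<and> v \<in> B \<and> card B = k}))"
    using card_UN_le[of "A - {1}" "\<lambda>v. {B. B \<subseteq> {1..m} \<and> 1 \<in> B \<and> v \<in> B \<and> card B = k}"] fA
    by (simp flip: of_nat_sum)
  also have "\<dots> \<le> (\<Sum>v\<in>A - {1}. (real k / real m)\<^sup>2 * real (m choose k))"
    using assms by (intro sum_mono card_subsets_containing2) auto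
  also have "\<dots> = real (card (A - {1})) * ((real k / real m)\<^sup>2 * real (m choose k))"
    by simp
  also have "\<dots> \<le> real (card A) * ((real k / real m)\<^sup>2 * real (m choose k))"
    using fA by (intro mult_right_mono of_nat_mono card_mono) auto
  also have "\<dots> = ?c * (real (card A) * real k / real m)"
    by (simp add: power2_eq_square)
  finally have 2: "real (card ?S) \<le> ?c * (real (card A) * real k / real m)" .
  have "real (card ?S) \<le> ?c * (real (card A) * real k / real m) powr (1/3)"
  \<comment> \<open>The interpolation divides by \<open>?c\<close>; if \<open>?c\<close> is 0, the
    first bound already makes the count 0.\<close>
  proof (cases "?c = 0")
    case True
    show ?thesis using 1 unfolding True by simp
  next
    case False
    with c have pos: "?c > 0" by linarith
    have "real (card ?S) / ?c \<le> (real (card A) * real k / real m) powr (1/3)"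
      by (rule le_powr_of_le_one) (use 1 2 pos in \<open>simp_all only: pos_divide_le_eq mult_1 mult.commute\<close>, simp_all)
    with pos show ?thesis by (simp only: pos_divide_le_eq mult.commute)
  qed
  then show ?thesis by (simp only: ac_simps)
qed

lemma sum_subsets_by_card:
  fixes h :: "nat \<Rightarrow> 'b::real_vector"
  assumes "Q \<subseteq> Pow {1..m}"
  shows "(\<Sum>A\<in>Q. h (card A)) = (\<Sum>k\<le>m. real (card {A \<in> Q. card A = k}) *\<^sub>R h k)"
proof -
  have fin: "finite Q" using assms finite_subset by blast
  have "card A \<le> m" if "A \<in> Q" for A
    using card_mono[of "{1..m}" A] that assms by auto
  then have "(\<Sum>A\<in>Q. h (card A)) = (\<Sum>k\<le>m. \<Sum>A\<in>{A \<in> Q. card A = k}. h (card A))"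
    using fin by (intro sum.group[symmetric]) auto
  also have "\<dots> = (\<Sum>k\<le>m. real (card {A \<in> Q. card A = k}) *\<^sub>R h k)"
    by (intro sum.cong refl) (simp add: scaleR_conv_of_real sum_constant_scaleR)
  finally show ?thesis .
qed

lemma integral_measure_pmf_atMost:
  fixes f :: "nat \<Rightarrow> 'b::{banach, second_countable_topology}"
  assumes "set_pmf p \<subseteq> {0..m}"
  shows "(\<integral>k. f k \<partial>measure_pmf p) = (\<Sum>k\<le>m. pmf p k *\<^sub>R f k)"
  by (rule integral_measure_pmf) (use assms in auto)

text \<open>If the sets through \<open>w\<close> meet pairwise only in \<open>w\<close>, then the
  neighbourhood of \<open>w\<close> is the disjoint union of the sets \<open>D j - {w}\<close>, so
  no neighbour is counted twice by the links.\<close>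

lemma rig_degree_eq_links:
  assumes D: "\<And>j. j \<in> {1..n} \<Longrightarrow> D j \<subseteq> {1..m}"
    and disj: "\<And>i j v. i \<in> {1..n} \<Longrightarrow> j \<in> {1..n} \<Longrightarrow> i \<noteq> j \<Longrightarrow> w \<in> D i \<Longrightarrow> w \<in> D j \<Longrightarrow>
        v \<in> D i \<inter> D j \<Longrightarrow> v = w"
  shows "rig_degree n m D w = rig_links n D w"
proof -
  let ?J = "{j \<in> {1..n}. w \<in> D j}"
  have fin: "finite (D j)" if "j \<in> {1..n}" for j
    using D[OF that] finite_subset by blast
  have D': "1 \<le> x \<and> x \<le> m" if "x \<in> D j" "j \<in> {1..n}" for x j
    using D[OF that(2)] that(1) by auto
  have "{w' \<in> {1..m}. rig_adj n D w w'} = (\<Union>j\<in>?J. D j - {w})"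
    using D by (auto simp: rig_adj_def dest: D')
  then have "rig_degree n m D w = card (\<Union>j\<in>?J. D j - {w})"
    by (simp add: rig_degree_def)
  also have "\<dots> = (\<Sum>j\<in>?J. card (D j - {w}))"
    using fin disj by (intro card_UN_disjoint) auto
  also have "\<dots> = (\<Sum>j\<in>?J. card (D j) - 1)"
    by (intro sum.cong) auto
  also have "\<dots> = rig_links n D w"
    unfolding rig_links_def by (intro sum.inter_filter) simp
  finally show ?thesis .
qed

section \<open>Law of a single random set and of the number of links\<close>

context passive_random_intersection_graph
begin

abbreviation set_prob :: "nat set \<Rightarrow> real" where
  "set_prob A \<equiv> pmf P (card A) / real (m choose card A)"

lemma measurable_D: "j \<in> {1..n} \<Longrightarrow> D j \<in> measurable M (count_space (Pow {1..m}))"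
  using indep_D by (auto simp: indep_vars_def)

lemma D_subset: "j \<in> {1..n} \<Longrightarrow> \<omega> \<in> space M \<Longrightarrow> D j \<omega> \<subseteq> {1..m}"
  using measurable_space[OF measurable_D] by (auto simp: space_count_space)

lemma measurable_fun_D [measurable]: "j \<in> {1..n} \<Longrightarrow> (\<lambda>\<omega>. f (D j \<omega>)) \<in> measurable M (count_space UNIV)"
  by (rule measurable_compose[OF measurable_D]) auto

lemma D_eq_event: "j \<in> {1..n} \<Longrightarrow> {\<omega> \<in> space M. D j \<omega> = A} \<in> events"
  using measurable_fun_D[of j "\<lambda>B. B = A"] by measurable

lemma integral_fun_D:
  fixes g :: "nat set \<Rightarrow> 'b::{banach, second_countable_topology}"
  assumes j: "j \<in> {1..n}"
  shows "(\<integral>\<omega>. g (D j \<omega>) \<partial>M) = (\<Sum>A\<in>Pow {1..m}. set_prob A *\<^sub>R g A)"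
proof -
  let ?E = "\<lambda>A. {\<omega> \<in> space M. D j \<omega> = A}"
  have "(\<integral>\<omega>. g (D j \<omega>) \<partial>M) = (\<integral>\<omega>. (\<Sum>A\<in>Pow {1..m}. indicator (?E A) \<omega> *\<^sub>R g A) \<partial>M)"
  proof (rule Bochner_Integration.integral_cong)
    fix \<omega> assume \<omega>: "\<omega> \<in> space M"
    have "(\<Sum>A\<in>Pow {1..m}. indicator (?E A) \<omega> *\<^sub>R g A) = (\<Sum>A\<in>Pow {1..m}. if A = D j \<omega> then g A else 0)"
      by (intro sum.cong) (use \<omega> in \<open>auto simp: indicator_def\<close>)
    also have "\<dots> = g (D j \<omega>)"
      using D_subset[OF j \<omega>] by simp
    finally show "g (D j \<omega>) = (\<Sum>A\<in>Pow {1..m}. indicator (?E A) \<omega> *\<^sub>R g A)" ..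
  qed simp
  also have "\<dots> = (\<Sum>A\<in>Pow {1..m}. \<integral>\<omega>. indicator (?E A) \<omega> *\<^sub>R g A \<partial>M)"
    by (intro Bochner_Integration.integral_sum integrable_scaleR_left integrable_indicator)
       (use j D_eq_event in \<open>auto simp: emeasure_eq_measure\<close>)
  also have "\<dots> = (\<Sum>A\<in>Pow {1..m}. set_prob A *\<^sub>R g A)"
  proof (intro sum.cong refl)
    fix A assume "A \<in> Pow {1..m}"
    then show "(\<integral>\<omega>. indicator (?E A) \<omega> *\<^sub>R g A \<partial>M) = set_prob A *\<^sub>R g A"
      using D_eq_event[OF j, of A] prob_D[OF j, of A]
      by (subst integral_scaleR_left) (auto simp: emeasure_eq_measure)
  qed
  finally show ?thesis .
qed

text \<open>Grouping the sets by size cancels the binomial in \<open>set_prob\<close> against the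
  number of \<open>k\<close>-sets containing 1 and leaves the factor \<open>k / m\<close>.\<close>

lemma sum_set_prob_containing:
  fixes f :: "nat \<Rightarrow> 'b::{banach, second_countable_topology}"
  assumes "m \<ge> 1"
  shows "(\<Sum>A\<in>Pow {1..m}. set_prob A *\<^sub>R (if 1 \<in> A then f (card A) else 0))
    = (1 / real m) *\<^sub>R (\<integral>k. real k *\<^sub>R f k \<partial>measure_pmf P)"
proof -
  let ?Q = "{A \<in> Pow {1..m}. 1 \<in> A}"
  have "(\<Sum>A\<in>Pow {1..m}. set_prob A *\<^sub>R (if 1 \<in> A then f (card A) else 0)) = (\<Sum>A\<in>?Q. set_prob A *\<^sub>R f (card A))"
    by (subst sum.inter_filter) (auto intro!: sum.cong)
  also have "\<dots> = (\<Sum>k\<le>m. real (card {A \<in> ?Q. card A = k}) *\<^sub>R ((pmf P k / real (m choose k)) *\<^sub>R f k))"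
    by (rule sum_subsets_by_card) auto
  also have "\<dots> = (\<Sum>k\<le>m. (1 / real m) *\<^sub>R (pmf P k *\<^sub>R (real k *\<^sub>R f k)))"
  proof (intro sum.cong refl)
    fix k assume "k \<in> {..m}"
    then have "real (m choose k) \<noteq> 0" by simp
    moreover have "{A \<in> ?Q. card A = k} = {B. B \<subseteq> {1..m} \<and> 1 \<in> B \<and> card B = k}"
      by auto
    ultimately show "real (card {A \<in> ?Q. card A = k}) *\<^sub>R ((pmf P k / real (m choose k)) *\<^sub>R f k)
        = (1 / real m) *\<^sub>R (pmf P k *\<^sub>R (real k *\<^sub>R f k))"
      by (simp only: card_subsets_containing[OF assms]) simp
  qed
  finally show ?thesis
    by (simp add: integral_measure_pmf_atMost[OF set_pmf_P] scaleR_right.sum)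
qed

lemma measurable_links: "(\<lambda>\<omega>. rig_links n (\<lambda>j. D j \<omega>) w) \<in> measurable M (count_space UNIV)"
  unfolding rig_links_def
  by (rule measurable_sum_nat) (rule measurable_fun_D[where f = "\<lambda>A. if w \<in> A then card A - 1 else 0"])

lemma measurable_degree: "(\<lambda>\<omega>. rig_degree n m (\<lambda>j. D j \<omega>) w) \<in> measurable M (count_space UNIV)"
proof -
  have [measurable]: "Measurable.pred M (\<lambda>\<omega>. {w, w'} \<subseteq> D j \<omega>)" if "j \<in> {1..n}" for j w'
    using measurable_fun_D[OF that, of "\<lambda>A. {w, w'} \<subseteq> A"] .
  have [measurable]: "Measurable.pred M (\<lambda>\<omega>. rig_adj n (\<lambda>j. D j \<omega>) w w')" for w'
    unfolding rig_adj_def by (intro pred_intros_logic pred_intros_finite) auto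
  have "rig_degree n m (\<lambda>j. D j \<omega>) w = (\<Sum>w'\<in>{1..m}. if rig_adj n (\<lambda>j. D j \<omega>) w w' then 1 else 0)" for \<omega>
    unfolding rig_degree_def by (simp flip: sum.inter_filter)
  then show ?thesis
    by (auto intro!: measurable_sum_nat)
qed

lemma char_links:
  assumes "m \<ge> 1"
  shows "char (real_law M (\<lambda>\<omega>. rig_links n (\<lambda>j. D j \<omega>) 1)) t =
    (1 + of_real (1 / real m) * measure_pmf.expectation P (\<lambda>k. of_nat k * (iexp (t * real (k - 1)) - 1))) ^ n"
proof -
  define y :: "nat set \<Rightarrow> nat" where "y A = (if 1 \<in> A then card A - 1 else 0)" for A
  have ind: "indep_vars (\<lambda>_. borel) (\<lambda>j \<omega>. real (y (D j \<omega>))) {1..n}"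
    by (rule indep_vars_compose2[OF indep_D]) auto
  have single: "char (distr M borel (\<lambda>\<omega>. real (y (D j \<omega>)))) t =
      1 + of_real (1 / real m) * measure_pmf.expectation P (\<lambda>k. of_nat k * (iexp (t * real (k - 1)) - 1))"
    if j: "j \<in> {1..n}" for j
  proof -
    have "char (distr M borel (\<lambda>\<omega>. real (y (D j \<omega>)))) t = (\<integral>\<omega>. iexp (t * real (y (D j \<omega>))) \<partial>M)"
      using char_real_law[OF measurable_fun_D[OF j, of y]] by (simp add: real_law_def)
    also have "\<dots> = (\<Sum>A\<in>Pow {1..m}. set_prob A *\<^sub>R iexp (t * real (y A)))"
      by (rule integral_fun_D[OF j])
    \<comment> \<open>The exponential is split as 1 plus a correction that vanishes unless
      \<open>1 \<in> A\<close>, so that only sets containing 1 contribute beyond the total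
      mass.\<close>
    also have "\<dots> = (\<Sum>A\<in>Pow {1..m}. set_prob A *\<^sub>R 1 +
        set_prob A *\<^sub>R (if 1 \<in> A then iexp (t * real (card A - 1)) - 1 else 0))"
      by (intro sum.cong refl) (simp add: y_def flip: scaleR_add_right)
    also have "\<dots> = 1 + (1 / real m) *\<^sub>R (\<integral>k. real k *\<^sub>R (iexp (t * real (k - 1)) - 1) \<partial>measure_pmf P)"
      unfolding sum.distrib sum_set_prob_containing[OF assms, of "\<lambda>k. iexp (t * real (k - 1)) - 1"]
      using integral_fun_D[OF j, of "\<lambda>_. 1 :: complex"] by (simp add: prob_space)
    finally show ?thesis
      by (simp add: scaleR_conv_of_real)
  qed
  have "char (real_law M (\<lambda>\<omega>. rig_links n (\<lambda>j. D j \<omega>) 1)) t = char (distr M borel (\<lambda>\<omega>. \<Sum>j\<in>{1..n}. real (y (D j \<omega>)))) t"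
    by (simp add: real_law_def rig_links_def y_def)
  also have "\<dots> = (\<Prod>j\<in>{1..n}. char (distr M borel (\<lambda>\<omega>. real (y (D j \<omega>)))) t)"
    by (rule char_distr_sum[OF ind])
  finally show ?thesis
    by (simp add: single)
qed

section \<open>Comparison of the degree with the number of links\<close>

lemma prob_D_pair:
  assumes "i \<in> {1..n}" "j \<in> {1..n}" "i \<noteq> j" "A \<subseteq> {1..m}" "B \<subseteq> {1..m}"
  shows "\<P>(\<omega> in M. D i \<omega> = A \<and> D j \<omega> = B) = set_prob A * set_prob B"
proof -
  have "prob (\<Inter>l\<in>{i, j}. D l -` (if l = i then {A} else {B}) \<inter> space M)
      = (\<Prod>l\<in>{i, j}. prob (D l -` (if l = i then {A} else {B}) \<inter> space M))"
    using assms by (intro indep_varsD[OF indep_D]) auto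
  moreover have "(\<Inter>l\<in>{i, j}. D l -` (if l = i then {A} else {B}) \<inter> space M) = {\<omega> \<in> space M. D i \<omega> = A \<and> D j \<omega> = B}"
    using assms by auto
  moreover have "D l -` {E} \<inter> space M = {\<omega> \<in> space M. D l \<omega> = E}" for l E
    by auto
  ultimately show ?thesis
    using assms prob_D by simp
qed

text \<open>First sum over the values \<open>B\<close> of \<open>D j\<close> with the value
  \<open>A\<close> of \<open>D i\<close> fixed, then over the sets \<open>A\<close> containing 1.
  Each summation yields a factor \<open>\<mu> / m\<close>, and the divisor \<open>m\<close> inside
  the cube root yields \<open>m powr (- (1/3))\<close>.\<close>

lemma prob_overlap_le:
  assumes "m \<ge> 1" and ij: "i \<in> {1..n}" "j \<in> {1..n}" "i \<noteq> j"
  shows "\<P>(\<omega> in M. 1 \<in> D i \<omega> \<and> 1 \<in> D j \<omega> \<and> (\<exists>v\<in>D i \<omega> \<inter> D j \<omega>. v \<noteq> 1))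
    \<le> (measure_pmf.expectation P (\<lambda>k. real k powr (4/3)) / real m)\<^sup>2 * real m powr (- (1/3))"
proof -
  define \<mu> where "\<mu> = measure_pmf.expectation P (\<lambda>k. real k powr (4/3))"
  let ?bad = "\<lambda>A B. 1 \<in> B \<and> (\<exists>v\<in>A \<inter> B. v \<noteq> 1)"
  let ?E = "\<lambda>A B. {\<omega> \<in> space M. D i \<omega> = A \<and> D j \<omega> = B}"
  let ?W = "Pow {1..m}"
  let ?K = "{(A, B) \<in> ?W \<times> ?W. 1 \<in> A \<and> ?bad A B}"
  have fin: "finite ?K"
    by (rule finite_subset[of _ "?W \<times> ?W"]) auto
  have E: "?E A B \<in> events" for A B
    using sets.Int[OF D_eq_event[OF ij(1), of A] D_eq_event[OF ij(2), of B]]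
    by (simp add: Int_def conj_ac)
  have powr43: "real k * real k powr (1/3) = real k powr (4/3)" for k
    by (cases "k = 0") (use powr_add[of "real k" 1 "1/3"] in auto)
  have if_mult: "(if a \<and> b then x * y else 0) = (if a then x else 0) * (if b then y else 0)"
    for a b and x y :: real
    by simp
  \<comment> \<open>For each size \<open>k\<close> the count of sets meeting \<open>A\<close>
    cancels the binomial, and \<open>k * k powr (1/3)\<close> builds up the moment
    \<open>\<mu>\<close>; the factor \<open>card A powr (1/3)\<close> is kept for the outer
    sum.\<close>
  have inner: "(\<Sum>B\<in>?W. if ?bad A B then set_prob B else 0)
      \<le> real (card A) powr (1/3) * (\<mu> / real m * real m powr (- (1/3)))" if A: "A \<in> ?W" for A
  proof -
    let ?Q = "{B \<in> ?W. ?bad A B}"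
    have "(\<Sum>B\<in>?W. if ?bad A B then set_prob B else 0) = (\<Sum>B\<in>?Q. set_prob B)"
      by (subst sum.inter_filter) auto
    also have "\<dots> = (\<Sum>k\<le>m. real (card {B \<in> ?Q. card B = k}) *\<^sub>R (pmf P k / real (m choose k)))"
      by (rule sum_subsets_by_card) auto
    also have "\<dots> \<le> (\<Sum>k\<le>m. real (card A) powr (1/3) * (pmf P k *\<^sub>R real k powr (4/3) / real m * real m powr (- (1/3))))"
    proof (intro sum_mono)
      fix k assume k: "k \<in> {..m}"
      have "{B \<in> ?Q. card B = k} = {B. B \<subseteq> {1..m} \<and> 1 \<in> B \<and> (\<exists>v\<in>A \<inter> B. v \<noteq> 1) \<and> card B = k}"
        by auto
      then have "real (card {B \<in> ?Q. card B = k}) * (pmf P k / real (m choose k))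
          \<le> (real k / real m * (real (card A) * real k / real m) powr (1/3) * real (m choose k)) * (pmf P k / real (m choose k))"
        using card_subsets_meeting[of m A k] assms(1) A k by (intro mult_right_mono) auto
      also have "\<dots> = real (card A) powr (1/3) * (pmf P k * (real k * real k powr (1/3)) / real m * real m powr (- (1/3)))"
        using k by (simp add: powr_divide powr_mult powr_minus field_simps)
      finally show "real (card {B \<in> ?Q. card B = k}) *\<^sub>R (pmf P k / real (m choose k))
          \<le> real (card A) powr (1/3) * (pmf P k *\<^sub>R real k powr (4/3) / real m * real m powr (- (1/3)))"
        by (simp only: powr43 real_scaleR_def)
    qed
    also have "\<dots> = real (card A) powr (1/3) * (\<mu> / real m * real m powr (- (1/3)))"
      unfolding \<mu>_def integral_measure_pmf_atMost[OF set_pmf_P]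
      by (simp add: sum_distrib_left sum_distrib_right sum_divide_distrib)
    finally show ?thesis .
  qed
  have "{\<omega> \<in> space M. 1 \<in> D i \<omega> \<and> ?bad (D i \<omega>) (D j \<omega>)}
      = (\<Union>(A, B)\<in>?K. ?E A B)"
    using D_subset[OF ij(1)] D_subset[OF ij(2)] by auto
  then have "\<P>(\<omega> in M. 1 \<in> D i \<omega> \<and> ?bad (D i \<omega>) (D j \<omega>))
      \<le> (\<Sum>(A, B)\<in>?K. prob (?E A B))"
    using finite_measure_subadditive_finite[OF fin, of "\<lambda>(A, B). ?E A B"] E
    by (simp only: case_prod_unfold image_subset_iff) simp
  also have "\<dots> = (\<Sum>(A, B)\<in>?K. set_prob A * set_prob B)"
    using prob_D_pair[OF ij] by (intro sum.cong) auto
  also have "\<dots> = (\<Sum>(A, B)\<in>?W \<times> ?W. if 1 \<in> A \<and> ?bad A B then set_prob A * set_prob B else 0)"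
  proof -
    have K: "?K = {x \<in> ?W \<times> ?W. 1 \<in> fst x \<and> ?bad (fst x) (snd x)}" by auto
    show ?thesis
      by (subst K, subst sum.inter_filter, simp) (simp only: case_prod_unfold)
  qed
  also have "\<dots> = (\<Sum>A\<in>?W. \<Sum>B\<in>?W. if 1 \<in> A \<and> ?bad A B then set_prob A * set_prob B else 0)"
    by (rule sum.cartesian_product[symmetric])
  also have "\<dots> = (\<Sum>A\<in>?W. (if 1 \<in> A then set_prob A else 0) * (\<Sum>B\<in>?W. if ?bad A B then set_prob B else 0))"
    unfolding sum_distrib_left by (intro sum.cong refl) (rule if_mult)
  also have "\<dots> \<le> (\<Sum>A\<in>?W. (if 1 \<in> A then set_prob A else 0) * (real (card A) powr (1/3) * (\<mu> / real m * real m powr (- (1/3)))))"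
    by (intro sum_mono mult_left_mono inner) auto
  also have "\<dots> = (\<Sum>A\<in>?W. set_prob A *\<^sub>R (if 1 \<in> A then real (card A) powr (1/3) else 0)) * (\<mu> / real m * real m powr (- (1/3)))"
    unfolding sum_distrib_right by (intro sum.cong refl) simp
  also have "\<dots> = (\<mu> / real m)\<^sup>2 * real m powr (- (1/3))"
    unfolding sum_set_prob_containing[OF assms(1), of "\<lambda>k. real k powr (1/3)"]
    by (simp add: powr43 \<mu>_def power2_eq_square)
  finally show ?thesis
    by (simp only: \<mu>_def conj_ac)
qed

text \<open>A discrepancy forces an overlap beyond the point 1 for some pair of distinct indices; a
  union bound over at most \<open>n\<^sup>2\<close> ordered pairs gives the estimate.\<close>

lemma prob_degree_neq_links_le:
  assumes "m \<ge> 1"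
  shows "\<P>(\<omega> in M. rig_degree n m (\<lambda>j. D j \<omega>) 1 \<noteq> rig_links n (\<lambda>j. D j \<omega>) 1)
    \<le> (real n / real m * measure_pmf.expectation P (\<lambda>k. real k powr (4/3)))\<^sup>2 * real m powr (- (1/3))"
proof -
  let ?c = "(measure_pmf.expectation P (\<lambda>k. real k powr (4/3)) / real m)\<^sup>2 * real m powr (- (1/3))"
  let ?I = "{(i, j) \<in> {1..n} \<times> {1..n}. i \<noteq> j}"
  let ?E = "\<lambda>i j. {\<omega> \<in> space M. 1 \<in> D i \<omega> \<and> 1 \<in> D j \<omega> \<and> (\<exists>v\<in>D i \<omega> \<inter> D j \<omega>. v \<noteq> 1)}"
  have fin: "finite {(A, B) \<in> Pow {1..m} \<times> Pow {1..m}. 1 \<in> A \<and> 1 \<in> B \<and> (\<exists>v\<in>A \<inter> B. v \<noteq> 1)}"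
    by (rule finite_subset[of _ "Pow {1..m} \<times> Pow {1..m}"]) auto
  have E: "?E i j \<in> events" if ij: "i \<in> {1..n}" "j \<in> {1..n}" for i j
  proof -
    have "?E i j = (\<Union>(A, B)\<in>{(A, B) \<in> Pow {1..m} \<times> Pow {1..m}. 1 \<in> A \<and> 1 \<in> B \<and> (\<exists>v\<in>A \<inter> B. v \<noteq> 1)}.
        {\<omega> \<in> space M. D i \<omega> = A} \<inter> {\<omega> \<in> space M. D j \<omega> = B})"
      using D_subset[OF ij(1)] D_subset[OF ij(2)] by auto
    also have "\<dots> \<in> events"
      by (intro sets.finite_UN[OF fin]) (auto intro!: sets.Int D_eq_event ij)
    finally show ?thesis .
  qed
  have finI: "finite ?I"
    by (rule finite_subset[of _ "{1..n} \<times> {1..n}"]) auto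
  have ev: "(case x of (i, j) \<Rightarrow> ?E i j) \<in> events" if "x \<in> ?I" for x
  proof (cases x)
    case (Pair i j)
    with that have ij: "i \<in> {1..n}" "j \<in> {1..n}" by auto
    show ?thesis
      unfolding Pair prod.case by (rule E[OF ij])
  qed
  have "{\<omega> \<in> space M. rig_degree n m (\<lambda>j. D j \<omega>) 1 \<noteq> rig_links n (\<lambda>j. D j \<omega>) 1} \<subseteq> (\<Union>(i, j)\<in>?I. ?E i j)"
  proof
    fix \<omega> assume \<omega>: "\<omega> \<in> {\<omega> \<in> space M. rig_degree n m (\<lambda>j. D j \<omega>) 1 \<noteq> rig_links n (\<lambda>j. D j \<omega>) 1}"
    show "\<omega> \<in> (\<Union>(i, j)\<in>?I. ?E i j)"
    proof (rule ccontr)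
      assume "\<omega> \<notin> (\<Union>(i, j)\<in>?I. ?E i j)"
      with \<omega> have "rig_degree n m (\<lambda>j. D j \<omega>) 1 = rig_links n (\<lambda>j. D j \<omega>) 1"
        by (intro rig_degree_eq_links D_subset) auto
      with \<omega> show False by simp
    qed
  qed
  then have "\<P>(\<omega> in M. rig_degree n m (\<lambda>j. D j \<omega>) 1 \<noteq> rig_links n (\<lambda>j. D j \<omega>) 1) \<le> prob (\<Union>(i, j)\<in>?I. ?E i j)"
    by (rule finite_measure_mono[OF _ sets.finite_UN[OF finI ev]])
  also have "\<dots> \<le> (\<Sum>(i, j)\<in>?I. prob (?E i j))"
    using finite_measure_subadditive_finite[OF finI image_subsetI[OF ev]]
    by (simp only: case_prod_unfold)
  also have "\<dots> \<le> (\<Sum>(i, j)\<in>?I. ?c)"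
    using prob_overlap_le[OF assms] by (intro sum_mono) auto
  also have "\<dots> = real (card ?I) * ?c"
    by (simp add: case_prod_unfold)
  also have "\<dots> \<le> (real n)\<^sup>2 * ?c"
  proof (rule mult_right_mono)
    have "card ?I \<le> card ({1..n} \<times> {1..n})"
      by (intro card_mono) auto
    then show "real (card ?I) \<le> (real n)\<^sup>2"
      by (simp add: power2_eq_square flip: of_nat_mult)
  qed simp
  finally show ?thesis
    by (simp add: power_mult_distrib power_divide)
qed

text \<open>The two exponentials agree where degree and links agree, and two points of the unit
  circle are at distance at most 2.\<close>

lemma norm_char_degree_minus_links_le:
  "norm (char (real_law M (\<lambda>\<omega>. rig_degree n m (\<lambda>j. D j \<omega>) 1)) t - char (real_law M (\<lambda>\<omega>. rig_links n (\<lambda>j. D j \<omega>) 1)) t)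
    \<le> 2 * \<P>(\<omega> in M. rig_degree n m (\<lambda>j. D j \<omega>) 1 \<noteq> rig_links n (\<lambda>j. D j \<omega>) 1)"
proof -
  define d where "d \<omega> = rig_degree n m (\<lambda>j. D j \<omega>) 1" for \<omega>
  define L where "L \<omega> = rig_links n (\<lambda>j. D j \<omega>) 1" for \<omega>
  have [measurable]: "d \<in> measurable M (count_space UNIV)" "L \<in> measurable M (count_space UNIV)"
    using measurable_degree measurable_links by (simp_all add: d_def[abs_def] L_def[abs_def])
  let ?E = "{\<omega> \<in> space M. d \<omega> \<noteq> L \<omega>}"
  have "{\<omega> \<in> space M. real (d \<omega>) \<noteq> real (L \<omega>)} \<in> events"
    by (rule borel_measurable_neq) measurable
  then have E: "?E \<in> events" by simp
  have int: "integrable M (\<lambda>\<omega>. iexp (t * real (d \<omega>)))" "integrable M (\<lambda>\<omega>. iexp (t * real (L \<omega>)))"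
    by (auto intro!: integrable_const_bound[where B = 1])
  have "norm (char (real_law M d) t - char (real_law M L) t)
      = norm (\<integral>\<omega>. iexp (t * real (d \<omega>)) - iexp (t * real (L \<omega>)) \<partial>M)"
    using int by (simp add: char_real_law)
  also have "\<dots> \<le> (\<integral>\<omega>. norm (iexp (t * real (d \<omega>)) - iexp (t * real (L \<omega>))) \<partial>M)"
    by (rule integral_norm_bound)
  also have "\<dots> \<le> (\<integral>\<omega>. 2 * indicator ?E \<omega> \<partial>M)"
  proof (rule integral_mono)
    show "integrable M (\<lambda>\<omega>. norm (iexp (t * real (d \<omega>)) - iexp (t * real (L \<omega>))))"
      using int by (intro integrable_norm Bochner_Integration.integrable_diff)
    show "integrable M (\<lambda>\<omega>. 2 * indicator ?E \<omega> :: real)"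
      using E by (auto simp: emeasure_eq_measure)
    show "norm (iexp (t * real (d \<omega>)) - iexp (t * real (L \<omega>))) \<le> 2 * indicator ?E \<omega>" if "\<omega> \<in> space M" for \<omega>
      using norm_triangle_ineq4[of "iexp (t * real (d \<omega>))" "iexp (t * real (L \<omega>))"] that
      by (auto simp: indicator_def)
  qed
  also have "\<dots> = 2 * prob ?E"
    using E by simp
  finally show ?thesis
    by (simp only: d_def[abs_def] L_def[abs_def])
qed

end

section \<open>The limit theorem\<close>

text \<open>Provides the two bounds required by \<open>tendsto_one_plus_power_exp\<close>. With
  \<open>a = k / m\<close> in [0, 1], \<open>1 + z\<close> is an average of convex combinations of 1
  and a point of the unit circle; the real part of \<open>z\<close> averages nonnegative multiples
  of \<open>cos (x k) - 1\<close>.\<close>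

lemma size_biased_iexp_bounds:
  fixes x :: "nat \<Rightarrow> real"
  assumes p: "set_pmf p \<subseteq> {0..m}" and "m \<ge> 1"
  defines "z \<equiv> of_real (1 / real m) * measure_pmf.expectation p (\<lambda>k. of_nat k * (iexp (x k) - 1))"
  shows "norm (1 + z) \<le> 1" and "Re z \<le> 0"
proof -
  have sum1: "(\<Sum>k\<le>m. pmf p k) = 1"
    using integral_measure_pmf_atMost[OF p, of "\<lambda>_. 1 :: real"] by simp
  have z: "z = (\<Sum>k\<le>m. pmf p k *\<^sub>R (of_real (real k / real m) * (iexp (x k) - 1)))"
    unfolding z_def integral_measure_pmf_atMost[OF p] sum_distrib_left
    by (intro sum.cong refl) (simp add: scaleR_conv_of_real)
  have "1 = (\<Sum>k\<le>m. pmf p k *\<^sub>R (1 :: complex))"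
    using sum1 by (simp flip: scaleR_left.sum)
  then have "1 + z = (\<Sum>k\<le>m. pmf p k *\<^sub>R (1 + of_real (real k / real m) * (iexp (x k) - 1)))"
    unfolding z by (simp only: sum.distrib scaleR_add_right)
  also have "norm \<dots> \<le> (\<Sum>k\<le>m. pmf p k)"
  proof (rule sum_norm_le)
    fix k assume "k \<in> {..m}"
    then have a: "0 \<le> real k / real m" "real k / real m \<le> 1"
      using \<open>m \<ge> 1\<close> by auto
    define a where "a = real k / real m"
    have "norm (1 + of_real a * (iexp (x k) - 1)) = norm (of_real (1 - a) + of_real a * iexp (x k))"
      by (simp add: algebra_simps)
    also have "\<dots> \<le> norm (of_real (1 - a) :: complex) + norm (of_real a * iexp (x k))"
      by (rule norm_triangle_ineq)
    also have "\<dots> = 1"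
      using a unfolding a_def[symmetric] by (simp only: norm_of_real norm_mult norm_exp_i_times)
    finally show "norm (pmf p k *\<^sub>R (1 + of_real (real k / real m) * (iexp (x k) - 1))) \<le> pmf p k"
      unfolding a_def[symmetric] norm_scaleR by (simp add: mult_left_le)
  qed
  finally show "norm (1 + z) \<le> 1"
    by (simp only: sum1)
  show "Re z \<le> 0"
    unfolding z Re_sum
    by (intro sum_nonpos) (auto simp: Re_exp mult_nonneg_nonpos zero_le_mult_iff
      intro!: mult_nonneg_nonpos divide_nonpos_nonneg)
qed

theorem theorem3p1:
  fixes \<beta> :: real
    and n :: "nat \<Rightarrow> nat"
    and P :: "nat \<Rightarrow> nat pmf"
    and M :: "nat \<Rightarrow> 'a measure"
    and D :: "nat \<Rightarrow> nat \<Rightarrow> 'a \<Rightarrow> nat set"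
    and N :: "'b measure"
    and Z :: "'b \<Rightarrow> nat"
    and S :: "'c measure"
    and \<Lambda> :: "'c \<Rightarrow> nat"
    and Zt :: "nat \<Rightarrow> 'c \<Rightarrow> nat"
  assumes "\<beta> > 0"
    and "filterlim n at_top sequentially"
    and "(\<lambda>m. real m / real (n m)) \<longlonglongrightarrow> \<beta>"
    and "\<And>m. m \<ge> 1 \<Longrightarrow> passive_random_intersection_graph (M m) (n m) m (P m) (D m)"
    and "prob_space N"
    and "Z \<in> measurable N (count_space UNIV)"
    and vii: "weak_conv_m (\<lambda>m. real_law (measure_pmf (P m)) (\<lambda>x. x)) (real_law N Z)"
    and viii_finite: "integrable N (\<lambda>\<omega>. real (Z \<omega>))"
    and viii_lim: "(\<lambda>m. measure_pmf.expectation (P m) real) \<longlonglongrightarrow> (\<integral>\<omega>. real (Z \<omega>) \<partial>N)"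
    and "compound_poisson S ((\<integral>\<omega>. real (Z \<omega>) \<partial>N) / \<beta>) (size_biased_mass N Z) \<Lambda> Zt"
  shows "weak_conv_m (\<lambda>m. real_law (M m) (\<lambda>\<omega>. rig_links (n m) (\<lambda>j. D m j \<omega>) 1))
           (real_law S (random_sum \<Lambda> Zt)) \<and>
         (integrable N (\<lambda>\<omega>. real (Z \<omega>) powr (4/3)) \<and>
          (\<lambda>m. measure_pmf.expectation (P m) (\<lambda>x. real x powr (4/3)))
             \<longlonglongrightarrow> (\<integral>\<omega>. real (Z \<omega>) powr (4/3) \<partial>N)
          \<longrightarrow>
          weak_conv_m (\<lambda>m. real_law (M m) (\<lambda>\<omega>. rig_degree (n m) m (\<lambda>j. D m j \<omega>) 1))
            (real_law S (random_sum \<Lambda> Zt)))"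
proof -
  interpret N: prob_space N by (rule assms(5))
  interpret cp: compound_poisson S "(\<integral>\<omega>. real (Z \<omega>) \<partial>N) / \<beta>" "size_biased_mass N Z" \<Lambda> Zt
    by (rule assms(10))
  \<comment> \<open>The index is shifted by one because the model is assumed only for m \<ge>
    1.\<close>
  interpret g: passive_random_intersection_graph "M (Suc i)" "n (Suc i)" "Suc i" "P (Suc i)" "D (Suc i)" for i
    by (rule assms(4)) simp
  note [measurable] = assms(6)
  obtain q where q: "measure_pmf q = distr N (count_space UNIV) Z" "\<And>k. pmf q k = \<P>(\<omega> in N. Z \<omega> = k)"
    using N.law_as_pmf[OF assms(6)] by blast
  \<comment> \<open>Replacing \<open>Z\<close> by its mass function \<open>q\<close> puts (vii) into
    the form that gives convergence of each mass.\<close>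
  have "real_law N Z = real_law (measure_pmf q) (\<lambda>x. x)"
    unfolding real_law_def q(1) by (subst distr_distr) (auto simp: comp_def)
  with vii have "(\<lambda>i. pmf (P i) k) \<longlonglongrightarrow> pmf q k" for k
    by (intro weak_conv_m_real_law_pmf) simp
  then have pmf_lim: "(\<lambda>i. pmf (P (Suc i)) k) \<longlonglongrightarrow> pmf q k" for k
    by (rule LIMSEQ_Suc)
  have int_P: "integrable (measure_pmf (P (Suc i))) real" for i
    using finite_subset[OF g.set_pmf_P] by (intro integrable_measure_pmf_finite) simp
  have int_q: "integrable (measure_pmf q) real" and Eq: "measure_pmf.expectation q real = (\<integral>\<omega>. real (Z \<omega>) \<partial>N)"
    using viii_finite unfolding q(1) by (auto simp: integrable_distr_eq integral_distr)
  have ratio: "(\<lambda>i. real (n (Suc i)) / real (Suc i)) \<longlonglongrightarrow> 1 / \<beta>"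
    using tendsto_inverse[OF LIMSEQ_Suc[OF assms(3)]] assms(1) by (simp add: inverse_eq_divide)
  have nSuc: "filterlim (\<lambda>i. n (Suc i)) at_top sequentially"
    by (rule filterlim_compose[OF assms(2) filterlim_Suc])
  let ?L = "\<lambda>m. real_law (M m) (\<lambda>\<omega>. rig_links (n m) (\<lambda>j. D m j \<omega>) 1)"
  let ?d = "\<lambda>m. real_law (M m) (\<lambda>\<omega>. rig_degree (n m) m (\<lambda>j. D m j \<omega>) 1)"
  let ?S = "real_law S (random_sum \<Lambda> Zt)"
  have char_L: "(\<lambda>i. char (?L (Suc i)) t) \<longlonglongrightarrow> char ?S t" for t
  proof -
    \<comment> \<open>\<open>1 + z i\<close> is the characteristic function of one summand of the
      links, and multiplying \<open>z i\<close> by the number of sets leaves the ratio n / m, with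
      limit \<open>1 / \<beta>\<close>, in front of \<open>c\<close>.\<close>
    define c where "c p = measure_pmf.expectation p (\<lambda>k. of_nat k * (iexp (t * real (k - 1)) - 1))" for p
    define z where "z i = of_real (1 / real (Suc i)) * c (P (Suc i))" for i
    have "(\<lambda>i. c (P (Suc i))) \<longlonglongrightarrow> c q"
      unfolding c_def
    proof (rule tendsto_size_biased_expectation[OF pmf_lim int_P int_q])
      show "(\<lambda>i. measure_pmf.expectation (P (Suc i)) real) \<longlonglongrightarrow> measure_pmf.expectation q real"
        unfolding Eq by (rule LIMSEQ_Suc[OF viii_lim])
      show "norm (iexp (t * real (k - 1)) - 1) \<le> 2" for k
        using norm_triangle_ineq4[of "iexp (t * real (k - 1))" 1] by simp
    qed
    then have "(\<lambda>i. of_real (real (n (Suc i)) / real (Suc i)) * c (P (Suc i))) \<longlonglongrightarrow> of_real (1 / \<beta>) * c q"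
      by (intro tendsto_mult tendsto_of_real ratio)
    then have "(\<lambda>i. of_nat (n (Suc i)) * z i) \<longlonglongrightarrow> of_real (1 / \<beta>) * c q"
      by (simp add: z_def del: of_nat_Suc)
    moreover have "norm (1 + z i) \<le> 1" "Re (z i) \<le> 0" for i
      unfolding z_def c_def by (rule size_biased_iexp_bounds[OF g.set_pmf_P], simp)+
    ultimately have "(\<lambda>i. (1 + z i) ^ n (Suc i)) \<longlonglongrightarrow> exp (of_real (1 / \<beta>) * c q)"
      by (intro tendsto_one_plus_power_exp nSuc)
    moreover have "char (?L (Suc i)) t = (1 + z i) ^ n (Suc i)" for i
      unfolding z_def c_def by (rule g.char_links) simp
    moreover have "char ?S t = exp (of_real (1 / \<beta>) * c q)"
      unfolding c_def by (rule char_compound_poisson_size_biased[OF assms(5,6) q viii_finite assms(10)])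
    ultimately show ?thesis by simp
  qed
  have rd_S: "real_distribution ?S"
    by (intro real_distribution_real_law cp.prob_space_axioms cp.measurable_random_sum)
  have "weak_conv_m ?L ?S"
    by (rule weak_conv_m_SucI, rule levy_continuity)
       (rule real_distribution_real_law g.prob_space_axioms g.measurable_links rd_S char_L)+
  moreover have "weak_conv_m ?d ?S"
    if lim43: "(\<lambda>m. measure_pmf.expectation (P m) (\<lambda>x. real x powr (4/3)))
      \<longlonglongrightarrow> (\<integral>\<omega>. real (Z \<omega>) powr (4/3) \<partial>N)"
  proof -
    have char_d: "(\<lambda>i. char (?d (Suc i)) t) \<longlonglongrightarrow> char ?S t" for t
    proof -
      \<comment> \<open>The squared factor converges to a finite limit by \<open>ratio\<close> and
        \<open>lim43\<close>, so the power of \<open>Suc i\<close> sends the bound to 0.\<close>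
      let ?b = "\<lambda>i. (real (n (Suc i)) / real (Suc i) * measure_pmf.expectation (P (Suc i)) (\<lambda>k. real k powr (4/3)))\<^sup>2
        * real (Suc i) powr (- (1/3))"
      have "filterlim (\<lambda>i. real (Suc i)) at_top sequentially"
        by (rule filterlim_compose[OF filterlim_real_sequentially filterlim_Suc])
      then have "(\<lambda>i. real (Suc i) powr (- (1/3))) \<longlonglongrightarrow> 0"
        by (intro tendsto_neg_powr) auto
      then have "(\<lambda>i. 2 * ?b i) \<longlonglongrightarrow> 2 * ((1 / \<beta> * (\<integral>\<omega>. real (Z \<omega>) powr (4/3) \<partial>N))\<^sup>2 * 0)"
        by (intro tendsto_mult tendsto_const tendsto_power ratio LIMSEQ_Suc[OF lim43])
      then have b0: "(\<lambda>i. 2 * ?b i) \<longlonglongrightarrow> 0"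
        by (simp only: mult_zero_right)
      have "norm (char (?d (Suc i)) t - char (?L (Suc i)) t) \<le> 2 * ?b i" for i
        by (rule order_trans[OF g.norm_char_degree_minus_links_le mult_left_mono[OF g.prob_degree_neq_links_le]]) simp_all
      then have "(\<lambda>i. char (?d (Suc i)) t - char (?L (Suc i)) t) \<longlonglongrightarrow> 0"
        by (intro Lim_null_comparison[OF _ b0] always_eventually allI)
      from tendsto_add[OF this char_L[of t]] show ?thesis by simp
    qed
    show ?thesis
      by (rule weak_conv_m_SucI, rule levy_continuity)
         (rule real_distribution_real_law g.prob_space_axioms g.measurable_degree rd_S char_d)+
  qed
  ultimately show ?thesis by blast
qed

end
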